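(* Let $\{M_\alpha:\alpha<2^\omega\}$ be a partition of $\mathbb R$ (into pairwise disjoint nonempty sets) such that $(\mathbb R_{[M_\alpha]})^\omega$ is Lindelöf for every $\alpha<2^\omega$. Put $A=M_0$, $B=M_1$, $C=\mathbb R\setminus(A\cup B)$, $\mathsf L=A\cup C$, $\mathsf R=B\cup C$, and let $$\mathsf G_1=B(\mathsf L_{[A]}),\quad \mathsf H_1=B(\mathsf R_{[B]}),\quad \mathsf G_2=B(\mathsf L_{(A]}),\quad \mathsf H_2=B(\mathsf R_{[B)}),$$ where $B(\cdot)$ denotes the free Boolean topological group. Then the topological groups $\mathsf G_1,\mathsf H_1,\mathsf G_2,\mathsf H_2$ are Lindelöf to countable degree (i.e. the countable power $G^\omega$ of each of these groups $G$ is Lindelöf), and: (1) The group $\mathsf G_1\times\mathsf H_1$ is not $\mathsf{SG}_{cnw}$-factorizable (and hence not $\mathbb R$-factorizable), and it has discrete Suslin number $2^\omega$. (2) The group $\mathsf G_2\times\mathsf H_2$ is not $\mathsf{SG}_{cnw}$-factorizable (and hence not $\mathbb R$-factorizable), is separable, is not normal, and has extent $2^\omega$.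
   Context: Topologies: for $X\subset\mathbb R$ and $A\subset X$, let $\tau$ be the topology on $X$ induced from $\mathbb R$. $X_{[A]}$ is the set $X$ with the topology having subbase $\tau\cup\{\{x\}:x\in X\setminus A\}$; $X_{[A)}$ is $X$ with the topology having subbase $\tau\cup\{X\cap[x,+\infty):x\in X\setminus A\}$; $X_{(A]}$ is $X$ with the topology having subbase $\tau\cup\{X\cap(-\infty,x]:x\in X\setminus A\}$. A partition $\{M_\alpha:\alpha<2^\omega\}$ as in the claim is known to exist (Okunev and Tamano, 1996). Free Boolean topological group: for a (Tychonoff) space $X$, $B(X)$ is the topological group of exponent $2$ generated by a topologically embedded copy of $X$ such that every continuous map from $X$ to a topological group of exponent $2$ extends to a continuous homomorphism on $B(X)$ (algebraically, the free Boolean group with basis $X$). Factorizability: a group with topology is a group endowed with a topology. It is semitopological if multiplication is separately continuous. $\mathsf{SG}_{cnw}$ is the class of semitopological groups with a countable network; $\mathsf{TG}_{sm}$ is the class of separable metrizable topological groups. For a class $\mathsf G$ of groups with topology, a group with topology $G$ is $\mathsf G$-factorizable if for every continuous $f:G\to\mathbb R$ there are a group $H\in\mathsf G$, a continuous homomorphism $\varphi:G\to H$ and a continuous function $h:H\to\mathbb R$ with $f=h\circ\varphi$. A topological group is $\mathbb R$-factorizable if it is $\mathsf{TG}_{sm}$-factorizable. Cardinal invariants: the discrete Suslin number of a space $X$ is the supremum of the cardinals $\kappa$ such that there is a discrete family of cardinality $\kappa$ of (nonempty) open subsets of $X$ (a family is discrete if every point has a neighbourhood meeting at most one member). The extent of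 $X$ is the supremum of the cardinalities of closed discrete subsets of $X$. *)

theory Defs
  imports
    "HOL-Analysis.Analysis"
    "HOL-Algebra.Generated_Groups"
    "HOL-Algebra.FiniteProduct"
    "HOL-Library.Equipollence"
begin

section \<open>Topologies on sets of reals\<close>

definition isolating_topology :: "real set \<Rightarrow> real set \<Rightarrow> real topology" where
  "isolating_topology X A = topology_generated_by
     ({U. openin (top_of_set X) U} \<union> {{x} |x. x \<in> X - A})"

definition left_closed_topology :: "real set \<Rightarrow> real set \<Rightarrow> real topology" where
  "left_closed_topology X A = topology_generated_by
     ({U. openin (top_of_set X) U} \<union> {X \<inter> {x..} |x. x \<in> X - A})"

definition right_closed_topology :: "real set \<Rightarrow> real set \<Rightarrow> real topology" where
  "right_closed_topology X A = topology_generated_by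
     ({U. openin (top_of_set X) U} \<union> {X \<inter> {..x} |x. x \<in> X - A})"

definition countable_power :: "'a topology \<Rightarrow> (nat \<Rightarrow> 'a) topology" where
  "countable_power X = product_topology (\<lambda>_. X) UNIV"


section \<open>Cardinal invariants\<close>

text \<open>The supremum of the cardinalities of the members of \<open>\<A>\<close> is the cardinality of \<open>K\<close>.
  Taking \<open>Y\<close> in the type of \<open>K\<close> is no restriction: a smaller upper bound is equipollent
  to a subset of \<open>K\<close>.\<close>

definition sup_card_is :: "'a set set \<Rightarrow> 'b set \<Rightarrow> bool" where
  "sup_card_is \<A> K \<longleftrightarrow>
     (\<forall>A\<in>\<A>. A \<lesssim> K) \<and> (\<forall>Y :: 'b set. (\<forall>A\<in>\<A>. A \<lesssim> Y) \<longrightarrow> K \<lesssim> Y)"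

definition discrete_family :: "'a topology \<Rightarrow> 'a set set \<Rightarrow> bool" where
  "discrete_family X \<V> \<longleftrightarrow>
     (\<forall>x\<in>topspace X. \<exists>U. openin X U \<and> x \<in> U \<and>
        (\<forall>V\<in>\<V>. \<forall>W\<in>\<V>. V \<inter> U \<noteq> {} \<and> W \<inter> U \<noteq> {} \<longrightarrow> V = W))"

definition discrete_suslin_number_is :: "'a topology \<Rightarrow> 'b set \<Rightarrow> bool" where
  "discrete_suslin_number_is X K \<longleftrightarrow>
     sup_card_is {\<V>. (\<forall>V\<in>\<V>. openin X V \<and> V \<noteq> {}) \<and> discrete_family X \<V>} K"

definition extent_is :: "'a topology \<Rightarrow> 'b set \<Rightarrow> bool" where
  "extent_is X K \<longleftrightarrow>
     sup_card_is {D. closedin X D \<and> subtopology X D = discrete_topology D} K"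

definition has_countable_network :: "'a topology \<Rightarrow> bool" where
  "has_countable_network X \<longleftrightarrow>
     (\<exists>\<N>. countable \<N> \<and>
        (\<forall>U x. openin X U \<and> x \<in> U \<longrightarrow> (\<exists>N\<in>\<N>. x \<in> N \<and> N \<subseteq> U)))"


section \<open>Groups with a topology\<close>

definition group_with_topology :: "'a monoid \<Rightarrow> 'a topology \<Rightarrow> bool" where
  "group_with_topology G T \<longleftrightarrow> group G \<and> topspace T = carrier G"

definition semitopological_group :: "'a monoid \<Rightarrow> 'a topology \<Rightarrow> bool" where
  "semitopological_group G T \<longleftrightarrow> group_with_topology G T \<and>
     (\<forall>a\<in>carrier G. continuous_map T T (\<lambda>x. a \<otimes>\<^bsub>G\<^esub> x) \<and>
                    continuous_map T T (\<lambda>x. x \<otimes>\<^bsub>G\<^esub> a))"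

definition topological_group :: "'a monoid \<Rightarrow> 'a topology \<Rightarrow> bool" where
  "topological_group G T \<longleftrightarrow> group_with_topology G T \<and>
     continuous_map (prod_topology T T) T (\<lambda>(x, y). x \<otimes>\<^bsub>G\<^esub> y) \<and>
     continuous_map T T (\<lambda>x. inv\<^bsub>G\<^esub> x)"

definition boolean_topological_group :: "'a monoid \<Rightarrow> 'a topology \<Rightarrow> bool" where
  "boolean_topological_group G T \<longleftrightarrow> topological_group G T \<and>
     (\<forall>x\<in>carrier G. x \<otimes>\<^bsub>G\<^esub> x = \<one>\<^bsub>G\<^esub>)"

definition SG_cnw :: "'a monoid \<Rightarrow> 'a topology \<Rightarrow> bool" where
  "SG_cnw G T \<longleftrightarrow> semitopological_group G T \<and> has_countable_network T"

definition TG_sm :: "'a monoid \<Rightarrow> 'a topology \<Rightarrow> bool" where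
  "TG_sm G T \<longleftrightarrow> topological_group G T \<and> separable_space T \<and> metrizable_space T"

text \<open>The class \<open>\<G>\<close> is evaluated on the groups whose elements have the type of those of \<open>G\<close>. For
  the classes above this is no restriction, since the image of \<open>G\<close> under a homomorphism has
  at most as many elements as \<open>G\<close>; see \<open>SG_cnw_factorization_any_type\<close> and
  \<open>TG_sm_factorization_any_type\<close> below.\<close>

definition factorizable ::
    "('a monoid \<Rightarrow> 'a topology \<Rightarrow> bool) \<Rightarrow> 'a monoid \<Rightarrow> 'a topology \<Rightarrow> bool" where
  "factorizable \<G> G T \<longleftrightarrow>
     (\<forall>f. continuous_map T euclideanreal f \<longrightarrow>
        (\<exists>H S \<phi> h. \<G> H S \<and> \<phi> \<in> hom G H \<and> continuous_map T S \<phi> \<and>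
           continuous_map S euclideanreal h \<and> (\<forall>x\<in>carrier G. f x = h (\<phi> x))))"

definition R_factorizable :: "'a monoid \<Rightarrow> 'a topology \<Rightarrow> bool" where
  "R_factorizable G T \<longleftrightarrow> factorizable TG_sm G T"

text \<open>\<open>(G, T)\<close> is the free Boolean topological group \<open>B(X)\<close>, with \<open>\<iota>\<close> the embedding of \<open>X\<close>.
  Test groups \<open>H\<close> on the type \<open>'x set\<close> suffice, since the subgroup generated by an image
  of \<open>X\<close> in a Boolean group has at most as many elements as there are finite subsets of \<open>X\<close>;
  see \<open>free_boolean_topological_group_universal\<close>, and
  \<open>free_boolean_topological_group_exists\<close> for existence.\<close>

definition free_boolean_topological_group ::
    "'x topology \<Rightarrow> 'a monoid \<Rightarrow> 'a topology \<Rightarrow> ('x \<Rightarrow> 'a) \<Rightarrow> bool" where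
  "free_boolean_topological_group X G T \<iota> \<longleftrightarrow>
     boolean_topological_group G T \<and>
     embedding_map X T \<iota> \<and>
     generate G (\<iota> ` topspace X) = carrier G \<and>
     (\<forall>(H :: 'x set monoid) S f.
        boolean_topological_group H S \<and> continuous_map X S f \<longrightarrow>
        (\<exists>g. g \<in> hom G H \<and> continuous_map T S g \<and> (\<forall>x\<in>topspace X. g (\<iota> x) = f x)))"


section \<open>Independence of the types of the test groups\<close>

lemma separable_metrizable_imp_second_countable:
  assumes "separable_space X" "metrizable_space X"
  shows "second_countable X"
proof -
  obtain M d where "Metric_space M d" and X: "X = Metric_space.mtopology M d"
    using assms(2) by (auto simp: metrizable_space_def)
  interpret Metric_space M d by fact
  obtain C where C: "countable C" "C \<subseteq> M" "mtopology closure_of C = M"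
    using assms(1) by (auto simp: separable_space_def X)
  define \<B> where "\<B> = (\<lambda>(c, n::nat). mball c (1 / Suc n)) ` (C \<times> UNIV)"
  have "\<exists>V\<in>\<B>. x \<in> V \<and> V \<subseteq> U" if U: "openin mtopology U" and x: "x \<in> U" for U x
  proof -
    have xM: "x \<in> M" and "\<exists>r>0. mball x r \<subseteq> U"
      using U x by (auto simp: openin_mtopology)
    then obtain r where r: "r > 0" "mball x r \<subseteq> U" by blast
    obtain n where n: "1 / real (Suc n) < r / 2"
      using r(1) nat_approx_posE[of "r / 2"] by (metis half_gt_zero)
    have "x \<in> mtopology closure_of C"
      using C xM by simp
    then have "\<forall>r>0. \<exists>c\<in>C. c \<in> mball x r"
      unfolding metric_closure_of by blast
    then obtain c where c: "c \<in> C" "c \<in> mball x (1 / Suc n)"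
      by (metis of_nat_0_less_iff zero_less_Suc zero_less_divide_1_iff)
    have "x \<in> mball c (1 / Suc n)"
      using c(2) unfolding in_mball by (metis commute)
    moreover have "mball c (1 / Suc n) \<subseteq> U"
    proof
      fix y assume y: "y \<in> mball c (1 / Suc n)"
      have "d x y \<le> d x c + d c y"
        using c(2) y triangle unfolding in_mball by blast
      also have "\<dots> < r"
        using c y n unfolding in_mball by linarith
      finally show "y \<in> U"
        using y xM r(2) by (auto simp: in_mball)
    qed
    ultimately show ?thesis
      using c(1) by (auto simp: \<B>_def intro!: bexI[of _ "(c, n)"])
  qed
  moreover have "countable \<B>" "\<forall>V\<in>\<B>. openin mtopology V"
    using C(1) by (auto simp: \<B>_def)
  ultimately show ?thesis
    unfolding second_countable_def X by metis
qed

definition transported_group :: "('h \<Rightarrow> 'g) \<Rightarrow> 'h set \<Rightarrow> 'h monoid \<Rightarrow> 'g monoid" where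
  "transported_group j K H = \<lparr>carrier = j ` K,
     mult = (\<lambda>x y. j (inv_into K j x \<otimes>\<^bsub>H\<^esub> inv_into K j y)), one = j \<one>\<^bsub>H\<^esub>\<rparr>"

definition transported_topology :: "('h \<Rightarrow> 'g) \<Rightarrow> 'h set \<Rightarrow> 'h topology \<Rightarrow> 'g topology" where
  "transported_topology j K S = pullback_topology (j ` K) (inv_into K j) S"

context
  fixes H :: "'h monoid" and S K and j :: "'h \<Rightarrow> 'g"
  assumes gwt: "group_with_topology H S" and sub: "subgroup K H" and inj: "inj_on j K"
begin

interpretation group H
  using gwt by (simp add: group_with_topology_def)

lemma transport_simps:
  "carrier (transported_group j K H) = j ` K"
  "\<one>\<^bsub>transported_group j K H\<^esub> = j \<one>\<^bsub>H\<^esub>"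
  "x \<in> K \<Longrightarrow> y \<in> K \<Longrightarrow> j x \<otimes>\<^bsub>transported_group j K H\<^esub> j y = j (x \<otimes>\<^bsub>H\<^esub> y)"
  "x \<in> K \<Longrightarrow> inv_into K j (j x) = x"
  using inj by (simp_all add: transported_group_def)

lemma transport_sub: "x \<in> K \<Longrightarrow> x \<in> carrier H"
  using subgroup.mem_carrier[OF sub] .

lemmas transport_closed = subgroup.m_closed[OF sub] subgroup.one_closed[OF sub] subgroup.m_inv_closed[OF sub]

lemma transport_group: "group (transported_group j K H)"
proof (rule groupI)
  fix x assume "x \<in> carrier (transported_group j K H)"
  then obtain u where u: "u \<in> K" "x = j u" by (auto simp: transport_simps)
  show "\<exists>y\<in>carrier (transported_group j K H). y \<otimes>\<^bsub>transported_group j K H\<^esub> x = \<one>\<^bsub>transported_group j K H\<^esub>"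
    by (rule bexI[of _ "j (inv\<^bsub>H\<^esub> u)"])
      (use u in \<open>auto simp: transport_simps transport_closed transport_sub\<close>)
qed (auto simp: transport_simps transport_closed transport_sub m_assoc)

lemma transport_inv:
  assumes "x \<in> K" shows "inv\<^bsub>transported_group j K H\<^esub> (j x) = j (inv\<^bsub>H\<^esub> x)"
  using assms
  by (intro group.inv_equality[OF transport_group])
    (auto simp: transport_simps transport_closed transport_sub)

lemma transport_hom: "\<phi> \<in> hom G H \<Longrightarrow> \<phi> ` carrier G \<subseteq> K \<Longrightarrow>
    (\<lambda>x. j (\<phi> x)) \<in> hom G (transported_group j K H)"
  by (rule homI) (auto simp: transport_simps hom_mult image_subset_iff)

lemma transport_hom_back: "inv_into K j \<in> hom (transported_group j K H) H"
  by (rule homI) (auto simp: transport_simps transport_closed transport_sub)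

lemma topspace_transport: "topspace (transported_topology j K S) = j ` K"
  using gwt transport_sub
  by (auto simp: transported_topology_def topspace_pullback_topology group_with_topology_def
      transport_simps)

lemma transport_gwt: "group_with_topology (transported_group j K H) (transported_topology j K S)"
  by (simp add: group_with_topology_def transport_group topspace_transport transport_simps)

lemma continuous_transport_back: "continuous_map (transported_topology j K S) S (inv_into K j)"
  unfolding transported_topology_def
  using continuous_map_pullback[of S S id "j ` K" "inv_into K j"] by simp

lemma continuous_transport_iff:
  assumes "g ` topspace X \<subseteq> j ` K"
  shows "continuous_map X (transported_topology j K S) g \<longleftrightarrow> continuous_map X S (\<lambda>x. inv_into K j (g x))"
proof
  assume "continuous_map X (transported_topology j K S) g"
  then show "continuous_map X S (\<lambda>x. inv_into K j (g x))"
    using continuous_map_compose[OF _ continuous_transport_back] by (simp add: o_def)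
next
  assume "continuous_map X S (\<lambda>x. inv_into K j (g x))"
  then show "continuous_map X (transported_topology j K S) g"
    unfolding transported_topology_def
    by (intro continuous_map_pullback') (use assms in \<open>auto simp: o_def\<close>)
qed

lemma continuous_transport:
  assumes "continuous_map X S \<phi>" "\<phi> ` topspace X \<subseteq> K"
  shows "continuous_map X (transported_topology j K S) (\<lambda>x. j (\<phi> x))"
proof (subst continuous_transport_iff)
  show "continuous_map X S (\<lambda>x. inv_into K j (j (\<phi> x)))"
    by (rule continuous_map_eq[OF assms(1)]) (use assms(2) in \<open>auto simp: transport_simps image_subset_iff\<close>)
qed (use assms in auto)

lemma homeomorphic_transport: "subtopology S K homeomorphic_space transported_topology j K S"
proof -
  have "homeomorphic_maps (subtopology S K) (transported_topology j K S) j (inv_into K j)"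
    unfolding homeomorphic_maps_def
  proof (intro conjI)
    show "continuous_map (subtopology S K) (transported_topology j K S) j"
      using continuous_transport[of "subtopology S K" "\<lambda>x. x"]
      by (auto simp: continuous_map_from_subtopology)
    show "continuous_map (transported_topology j K S) (subtopology S K) (inv_into K j)"
      by (auto simp: continuous_map_in_subtopology continuous_transport_back topspace_transport transport_simps)
  qed (auto simp: topspace_transport transport_simps)
  then show ?thesis by (auto simp: homeomorphic_space_def)
qed

lemma transport_semitopological:
  assumes "semitopological_group H S"
  shows "semitopological_group (transported_group j K H) (transported_topology j K S)"
  unfolding semitopological_group_def
proof (intro conjI ballI transport_gwt)
  fix a assume "a \<in> carrier (transported_group j K H)"
  then obtain u where u: "u \<in> K" "a = j u" by (auto simp: transport_simps)
  have *: "continuous_map S S (\<lambda>x. u \<otimes>\<^bsub>H\<^esub> x)" "continuous_map S S (\<lambda>x. x \<otimes>\<^bsub>H\<^esub> u)"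
    using assms u by (auto simp: semitopological_group_def transport_sub)
  note ** = continuous_map_compose[OF continuous_transport_back *(1)]
            continuous_map_compose[OF continuous_transport_back *(2)]
  let ?T = "transported_topology j K S"
  have "continuous_map ?T ?T (\<lambda>x. j (u \<otimes>\<^bsub>H\<^esub> inv_into K j x))"
    by (rule continuous_transport)
      (use **(1) u in \<open>auto simp: o_def topspace_transport transport_simps transport_closed\<close>)
  then show "continuous_map ?T ?T (\<lambda>x. a \<otimes>\<^bsub>transported_group j K H\<^esub> x)"
    by (rule continuous_map_eq) (use u in \<open>auto simp: topspace_transport transport_simps\<close>)
  have "continuous_map ?T ?T (\<lambda>x. j (inv_into K j x \<otimes>\<^bsub>H\<^esub> u))"
    by (rule continuous_transport)
      (use **(2) u in \<open>auto simp: o_def topspace_transport transport_simps transport_closed\<close>)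
  then show "continuous_map ?T ?T (\<lambda>x. x \<otimes>\<^bsub>transported_group j K H\<^esub> a)"
    by (rule continuous_map_eq) (use u in \<open>auto simp: topspace_transport transport_simps\<close>)
qed

lemma transport_topological:
  assumes "topological_group H S"
  shows "topological_group (transported_group j K H) (transported_topology j K S)"
  unfolding topological_group_def
proof (intro conjI transport_gwt)
  let ?T = "transported_topology j K S"
  have *: "continuous_map (prod_topology S S) S (\<lambda>(x, y). x \<otimes>\<^bsub>H\<^esub> y)" "continuous_map S S (\<lambda>x. inv\<^bsub>H\<^esub> x)"
    using assms by (auto simp: topological_group_def)
  have "continuous_map (prod_topology ?T ?T) (prod_topology S S)
          (\<lambda>(x, y). (inv_into K j x, inv_into K j y))"
    using continuous_transport_back by (simp add: continuous_map_prod_top)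
  from continuous_map_compose[OF this *(1)]
  have 1: "continuous_map (prod_topology ?T ?T) S (\<lambda>p. inv_into K j (fst p) \<otimes>\<^bsub>H\<^esub> inv_into K j (snd p))"
    by (simp add: o_def case_prod_unfold)
  have "continuous_map (prod_topology ?T ?T) ?T (\<lambda>p. j (inv_into K j (fst p) \<otimes>\<^bsub>H\<^esub> inv_into K j (snd p)))"
    by (rule continuous_transport[OF 1])
      (auto simp: topspace_transport transport_simps transport_closed)
  then show "continuous_map (prod_topology ?T ?T) ?T (\<lambda>(x, y). x \<otimes>\<^bsub>transported_group j K H\<^esub> y)"
    by (rule continuous_map_eq) (auto simp: topspace_transport transport_simps)
  have "continuous_map ?T ?T (\<lambda>x. j (inv\<^bsub>H\<^esub> (inv_into K j x)))"
    by (rule continuous_transport)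
      (use continuous_map_compose[OF continuous_transport_back *(2)] in
        \<open>auto simp: o_def topspace_transport transport_simps transport_closed\<close>)
  then show "continuous_map ?T ?T (\<lambda>x. inv\<^bsub>transported_group j K H\<^esub> x)"
    by (rule continuous_map_eq) (auto simp: topspace_transport transport_simps transport_inv)
qed

lemma transport_boolean:
  assumes "boolean_topological_group H S"
  shows "boolean_topological_group (transported_group j K H) (transported_topology j K S)"
  using assms transport_topological transport_sub
  by (auto simp: boolean_topological_group_def transport_simps)

lemma transport_network:
  assumes "has_countable_network S"
  shows "has_countable_network (transported_topology j K S)"
proof -
  obtain \<N> where N: "countable \<N>"
    "\<And>U x. openin S U \<Longrightarrow> x \<in> U \<Longrightarrow> \<exists>N\<in>\<N>. x \<in> N \<and> N \<subseteq> U"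
    using assms unfolding has_countable_network_def by metis
  have "\<exists>N\<in>(\<lambda>N. inv_into K j -` N \<inter> j ` K) ` \<N>. x \<in> N \<and> N \<subseteq> V"
    if "openin (transported_topology j K S) V" "x \<in> V" for V x
  proof -
    obtain U where U: "openin S U" "V = inv_into K j -` U \<inter> j ` K"
      using \<open>openin _ V\<close> by (auto simp: transported_topology_def openin_pullback_topology)
    obtain N where "N \<in> \<N>" "inv_into K j x \<in> N" "N \<subseteq> U"
      using N(2)[OF U(1), of "inv_into K j x"] U(2) \<open>x \<in> V\<close> by auto
    moreover from this have "x \<in> inv_into K j -` N \<inter> j ` K" "inv_into K j -` N \<inter> j ` K \<subseteq> V"
      using U(2) \<open>x \<in> V\<close> by auto
    ultimately show ?thesis by (metis image_eqI)
  qed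
  moreover have "countable ((\<lambda>N. inv_into K j -` N \<inter> j ` K) ` \<N>)"
    using N(1) by simp
  ultimately show ?thesis
    unfolding has_countable_network_def by metis
qed

lemma transport_SG_cnw:
  "SG_cnw H S \<Longrightarrow> SG_cnw (transported_group j K H) (transported_topology j K S)"
  by (simp add: SG_cnw_def transport_semitopological transport_network)

lemma transport_TG_sm:
  assumes "TG_sm H S" shows "TG_sm (transported_group j K H) (transported_topology j K S)"
proof -
  have "second_countable S"
    using assms by (simp add: TG_sm_def separable_metrizable_imp_second_countable)
  then have "separable_space (subtopology S K)" "metrizable_space (subtopology S K)"
    using assms by (auto simp: TG_sm_def metrizable_space_subtopology
        intro!: second_countable_imp_separable_space second_countable_subtopology)
  then show ?thesis
    using assms transport_topological homeomorphic_separable_space[OF homeomorphic_transport]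
      homeomorphic_metrizable_space[OF homeomorphic_transport]
    unfolding TG_sm_def by blast
qed

end


theorem SG_cnw_factorization_any_type:
  fixes G :: "'g monoid" and H :: "'h monoid"
  assumes G: "group_with_topology G T" and H: "SG_cnw H S"
    and \<phi>: "\<phi> \<in> hom G H" "continuous_map T S \<phi>" and h: "continuous_map S euclideanreal h"
  shows "\<exists>(H' :: 'g monoid) S' \<phi>' h'. SG_cnw H' S' \<and> \<phi>' \<in> hom G H' \<and> continuous_map T S' \<phi>' \<and>
           continuous_map S' euclideanreal h' \<and> (\<forall>x\<in>carrier G. h (\<phi> x) = h' (\<phi>' x))"
proof -
  define K where "K = \<phi> ` carrier G"
  define j where "j = inv_into (carrier G) \<phi>"
  have gwt: "group_with_topology H S"
    using H by (simp add: SG_cnw_def semitopological_group_def)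
  have sub: "subgroup K H"
    using G gwt \<phi>(1) unfolding K_def group_with_topology_def
    by (intro group_hom.img_is_subgroup) (simp add: group_hom_def group_hom_axioms_def)
  have inj: "inj_on j K"
    by (simp add: K_def j_def inj_on_inv_into)
  have "continuous_map (transported_topology j K S) euclideanreal (\<lambda>y. h (inv_into K j y))"
    using continuous_map_compose[OF continuous_transport_back[OF gwt sub inj] h] by (simp add: o_def)
  moreover have "continuous_map T (transported_topology j K S) (\<lambda>x. j (\<phi> x))"
    using G by (intro continuous_transport[OF gwt sub inj] \<phi>) (auto simp: K_def group_with_topology_def)
  moreover have "(\<lambda>x. j (\<phi> x)) \<in> hom G (transported_group j K H)"
    by (intro transport_hom[OF gwt sub inj] \<phi>) (simp add: K_def)
  ultimately show ?thesis
    using transport_SG_cnw[OF gwt sub inj H] inj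
    by (intro exI[of _ "transported_group j K H"] exI[of _ "transported_topology j K S"]
        exI[of _ "\<lambda>x. j (\<phi> x)"] exI[of _ "\<lambda>y. h (inv_into K j y)"]) (auto simp: K_def)
qed

theorem TG_sm_factorization_any_type:
  fixes G :: "'g monoid" and H :: "'h monoid"
  assumes G: "group_with_topology G T" and H: "TG_sm H S"
    and \<phi>: "\<phi> \<in> hom G H" "continuous_map T S \<phi>" and h: "continuous_map S euclideanreal h"
  shows "\<exists>(H' :: 'g monoid) S' \<phi>' h'. TG_sm H' S' \<and> \<phi>' \<in> hom G H' \<and> continuous_map T S' \<phi>' \<and>
           continuous_map S' euclideanreal h' \<and> (\<forall>x\<in>carrier G. h (\<phi> x) = h' (\<phi>' x))"
proof -
  define K where "K = \<phi> ` carrier G"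
  define j where "j = inv_into (carrier G) \<phi>"
  have gwt: "group_with_topology H S"
    using H by (simp add: TG_sm_def topological_group_def)
  have sub: "subgroup K H"
    using G gwt \<phi>(1) unfolding K_def group_with_topology_def
    by (intro group_hom.img_is_subgroup) (simp add: group_hom_def group_hom_axioms_def)
  have inj: "inj_on j K"
    by (simp add: K_def j_def inj_on_inv_into)
  have "continuous_map (transported_topology j K S) euclideanreal (\<lambda>y. h (inv_into K j y))"
    using continuous_map_compose[OF continuous_transport_back[OF gwt sub inj] h] by (simp add: o_def)
  moreover have "continuous_map T (transported_topology j K S) (\<lambda>x. j (\<phi> x))"
    using G by (intro continuous_transport[OF gwt sub inj] \<phi>) (auto simp: K_def group_with_topology_def)
  moreover have "(\<lambda>x. j (\<phi> x)) \<in> hom G (transported_group j K H)"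
    by (intro transport_hom[OF gwt sub inj] \<phi>) (simp add: K_def)
  ultimately show ?thesis
    using transport_TG_sm[OF gwt sub inj H] inj
    by (intro exI[of _ "transported_group j K H"] exI[of _ "transported_topology j K S"]
        exI[of _ "\<lambda>x. j (\<phi> x)"] exI[of _ "\<lambda>y. h (inv_into K j y)"]) (auto simp: K_def)
qed

lemma boolean_comm_group:
  assumes "group G" "\<forall>x\<in>carrier G. x \<otimes>\<^bsub>G\<^esub> x = \<one>\<^bsub>G\<^esub>"
  shows "comm_group G"
proof -
  interpret group G by fact
  show ?thesis
    using assms(2) by (intro group_comm_groupI) (metis inv_equality inv_mult_group m_closed)
qed

lemma boolean_finprod_sym_diff:
  fixes G (structure)
  assumes "comm_group G" "\<forall>x\<in>carrier G. x \<otimes> x = \<one>" "f \<in> X \<rightarrow> carrier G"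
    and P: "finite P" "P \<subseteq> X" and Q: "finite Q" "Q \<subseteq> X"
  shows "finprod G f (sym_diff P Q) = finprod G f P \<otimes> finprod G f Q"
proof -
  interpret comm_group G by fact
  have f: "f \<in> Y \<rightarrow> carrier G" if "Y \<subseteq> X" for Y
    using assms(3) that by auto
  have split: "finprod G f Y = finprod G f (Y - Z) \<otimes> finprod G f (Y \<inter> Z)"
    if "finite Y" "Y \<subseteq> X" for Y Z
  proof -
    have "finprod G f ((Y - Z) \<union> (Y \<inter> Z)) = finprod G f (Y - Z) \<otimes> finprod G f (Y \<inter> Z)"
      by (rule finprod_Un_disjoint) (use that in \<open>auto intro!: f\<close>)
    moreover have "(Y - Z) \<union> (Y \<inter> Z) = Y" by auto
    ultimately show ?thesis by simp
  qed
  have cl: "finprod G f Y \<in> carrier G" if "Y \<subseteq> X" for Y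
    using f[OF that] by (rule finprod_closed)
  let ?a = "finprod G f (P - Q)" and ?b = "finprod G f (P \<inter> Q)" and ?c = "finprod G f (Q - P)"
  have abc: "?a \<in> carrier G" "?b \<in> carrier G" "?c \<in> carrier G"
    using P Q by (auto intro!: cl)
  have "finprod G f (sym_diff P Q) = ?a \<otimes> ?c"
    using P Q by (intro finprod_Un_disjoint f) auto
  also have "\<dots> = (?a \<otimes> ?b) \<otimes> (?c \<otimes> ?b)"
  proof -
    have "(?a \<otimes> ?b) \<otimes> (?c \<otimes> ?b) = (?a \<otimes> ?c) \<otimes> (?b \<otimes> ?b)"
      using abc by (simp add: m_ac)
    then show ?thesis using assms(2) abc by simp
  qed
  also have "\<dots> = finprod G f P \<otimes> finprod G f Q"
    using split[OF P, of Q] split[OF Q, of P] by (simp add: Int_commute)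
  finally show ?thesis .
qed

theorem free_boolean_topological_group_universal:
  fixes X :: "'x topology" and G :: "'g monoid" and H :: "'h monoid"
  assumes free: "free_boolean_topological_group X G T \<iota>"
    and H: "boolean_topological_group H S" and f: "continuous_map X S f"
  shows "\<exists>g. g \<in> hom G H \<and> continuous_map T S g \<and> (\<forall>x\<in>topspace X. g (\<iota> x) = f x)"
proof -
  have gwt: "group_with_topology H S" and gH: "group H"
    and boole: "\<forall>x\<in>carrier H. x \<otimes>\<^bsub>H\<^esub> x = \<one>\<^bsub>H\<^esub>"
    using H by (auto simp: boolean_topological_group_def topological_group_def group_with_topology_def)
  interpret H: comm_group H
    by (rule boolean_comm_group[OF gH boole])
  have fX: "f \<in> topspace X \<rightarrow> carrier H"
    using f gwt by (auto simp: continuous_map_def group_with_topology_def)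
  define K where "K = finprod H f ` Fpow (topspace X)"
  define j where "j = inv_into (Fpow (topspace X)) (finprod H f)"
  have sub: "subgroup K H"
  proof
    show "K \<subseteq> carrier H"
      using fX by (auto simp: K_def Fpow_def intro!: H.finprod_closed)
    then show "inv\<^bsub>H\<^esub> x \<in> K" if "x \<in> K" for x
      using that boole by (metis H.inv_equality subsetD)
    show "\<one>\<^bsub>H\<^esub> \<in> K"
      unfolding K_def by (rule image_eqI[of _ _ "{}"]) (auto simp: Fpow_def)
    show "x \<otimes>\<^bsub>H\<^esub> y \<in> K" if xy: "x \<in> K" "y \<in> K" for x y
    proof -
      obtain P Q where "x = finprod H f P" "y = finprod H f Q"
        "P \<subseteq> topspace X" "finite P" "Q \<subseteq> topspace X" "finite Q"
        using xy unfolding K_def Fpow_def by blast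
      then show ?thesis
        unfolding K_def
        by (intro image_eqI[of _ _ "sym_diff P Q"])
          (auto simp: Fpow_def boolean_finprod_sym_diff[OF H.comm_group_axioms boole fX])
    qed
  qed
  have fK: "f ` topspace X \<subseteq> K"
  proof
    fix y assume "y \<in> f ` topspace X"
    then obtain x where x: "x \<in> topspace X" "y = f x" by auto
    then have "f x \<in> carrier H" using fX by auto
    then show "y \<in> K"
      unfolding K_def using x by (intro image_eqI[of _ _ "{x}"]) (auto simp: Fpow_def)
  qed
  have inj: "inj_on j K"
    by (simp add: K_def j_def inj_on_inv_into)
  obtain g where g: "g \<in> hom G (transported_group j K H)"
      "continuous_map T (transported_topology j K S) g"
      "\<And>x. x \<in> topspace X \<Longrightarrow> g (\<iota> x) = j (f x)"
    using free transport_boolean[OF gwt sub inj H] continuous_transport[OF gwt sub inj f fK]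
    unfolding free_boolean_topological_group_def by metis
  show ?thesis
  proof (intro exI conjI ballI)
    show "inv_into K j \<circ> g \<in> hom G H"
      using hom_compose[OF g(1) transport_hom_back[OF gwt sub inj]] .
    show "continuous_map T S (inv_into K j \<circ> g)"
      using continuous_map_compose[OF g(2) continuous_transport_back[OF gwt sub inj]] .
    show "(inv_into K j \<circ> g) (\<iota> x) = f x" if "x \<in> topspace X" for x
      using that g(3) fK inj by auto
  qed
qed


section \<open>Existence of free Boolean topological groups\<close>

text \<open>Finite subsets of \<open>X\<close> under symmetric difference, with the supremum of all group topologies
  that make \<open>x \<mapsto> {x}\<close> continuous.\<close>

definition fin_sets_group :: "'x set \<Rightarrow> 'x set monoid" where
  "fin_sets_group Y = \<lparr>carrier = Fpow Y, mult = sym_diff, one = {}\<rparr>"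

lemma fin_sets_group_simps [simp]:
  "carrier (fin_sets_group Y) = Fpow Y"
  "P \<otimes>\<^bsub>fin_sets_group Y\<^esub> Q = sym_diff P Q"
  "\<one>\<^bsub>fin_sets_group Y\<^esub> = {}"
  by (simp_all add: fin_sets_group_def)

lemma group_fin_sets_group: "group (fin_sets_group Y)"
  by (rule groupI) (auto simp: Fpow_def)

lemma inv_fin_sets_group: "P \<in> Fpow Y \<Longrightarrow> inv\<^bsub>fin_sets_group Y\<^esub> P = P"
  by (rule group.inv_equality[OF group_fin_sets_group]) auto

lemma sym_diff_Fpow: "P \<in> Fpow Y \<Longrightarrow> Q \<in> Fpow Y \<Longrightarrow> sym_diff P Q \<in> Fpow Y"
  by (auto simp: Fpow_def)

lemma boolean_fin_sets_groupI:
  assumes "topspace S = Fpow Y"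
    and "continuous_map (prod_topology S S) S (\<lambda>(P, Q). sym_diff P Q)"
  shows "boolean_topological_group (fin_sets_group Y) S"
proof -
  have "continuous_map S S (\<lambda>P. inv\<^bsub>fin_sets_group Y\<^esub> P)"
    by (rule continuous_map_eq[of S S "\<lambda>P. P"]) (use assms(1) in \<open>auto simp: inv_fin_sets_group\<close>)
  then show ?thesis
    using assms by (simp add: boolean_topological_group_def topological_group_def
        group_with_topology_def group_fin_sets_group)
qed

lemma boolean_fin_sets_groupD:
  assumes "boolean_topological_group (fin_sets_group Y) S"
  shows "topspace S = Fpow Y" "continuous_map (prod_topology S S) S (\<lambda>(P, Q). sym_diff P Q)"
  using assms by (simp_all add: boolean_topological_group_def topological_group_def
        group_with_topology_def)

lemma generate_fin_sets_group: "generate (fin_sets_group Y) ((\<lambda>y. {y}) ` Y) = Fpow Y"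
proof
  show "generate (fin_sets_group Y) ((\<lambda>y. {y}) ` Y) \<subseteq> Fpow Y"
    using group.generate_incl[OF group_fin_sets_group, of "(\<lambda>y. {y}) ` Y" Y]
    by (auto simp: Fpow_def)
  have "P \<in> generate (fin_sets_group Y) ((\<lambda>y. {y}) ` Y)" if "finite P" "P \<subseteq> Y" for P
    using that
  proof (induction P rule: finite_induct)
    case empty
    then show ?case using generate.one[of "fin_sets_group Y"] by simp
  next
    case (insert y P)
    have "{y} \<otimes>\<^bsub>fin_sets_group Y\<^esub> P \<in> generate (fin_sets_group Y) ((\<lambda>y. {y}) ` Y)"
      by (rule generate.eng[OF generate.incl]) (use insert in auto)
    moreover have "sym_diff {y} P = insert y P"
      using insert by auto
    ultimately show ?case by simp
  qed
  then show "Fpow Y \<subseteq> generate (fin_sets_group Y) ((\<lambda>y. {y}) ` Y)"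
    by (auto simp: Fpow_def)
qed

lemma boolean_seminorm_topology:
  fixes N :: "'x set \<Rightarrow> real"
  assumes N0: "N {} = 0"
    and Ntri: "\<And>P Q. P \<in> Fpow Y \<Longrightarrow> Q \<in> Fpow Y \<Longrightarrow> N (sym_diff P Q) \<le> N P + N Q"
  obtains S where "boolean_topological_group (fin_sets_group Y) S"
    and "\<And>U. openin S U \<longleftrightarrow>
           U \<subseteq> Fpow Y \<and> (\<forall>P\<in>U. \<exists>e>0. \<forall>Q\<in>Fpow Y. N (sym_diff P Q) < e \<longrightarrow> Q \<in> U)"
    and "\<And>P e. P \<in> Fpow Y \<Longrightarrow> openin S {Q \<in> Fpow Y. N (sym_diff P Q) < e}"
proof -
  define S where "S = topology (\<lambda>U. U \<subseteq> Fpow Y \<and>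
      (\<forall>P\<in>U. \<exists>e>0. \<forall>Q\<in>Fpow Y. N (sym_diff P Q) < e \<longrightarrow> Q \<in> U))"
  have "istopology (\<lambda>U. U \<subseteq> Fpow Y \<and>
      (\<forall>P\<in>U. \<exists>e>0. \<forall>Q\<in>Fpow Y. N (sym_diff P Q) < e \<longrightarrow> Q \<in> U))"
    unfolding istopology_def
  proof (intro conjI allI impI ballI)
    fix U V P
    assume U: "U \<subseteq> Fpow Y \<and> (\<forall>P\<in>U. \<exists>e>0. \<forall>Q\<in>Fpow Y. N (sym_diff P Q) < e \<longrightarrow> Q \<in> U)"
      and V: "V \<subseteq> Fpow Y \<and> (\<forall>P\<in>V. \<exists>e>0. \<forall>Q\<in>Fpow Y. N (sym_diff P Q) < e \<longrightarrow> Q \<in> V)"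
      and P: "P \<in> U \<inter> V"
    obtain a where a: "a > 0" "\<And>Q. Q\<in>Fpow Y \<Longrightarrow> N (sym_diff P Q) < a \<Longrightarrow> Q \<in> U"
      using U P by (metis IntD1)
    obtain b where b: "b > 0" "\<And>Q. Q\<in>Fpow Y \<Longrightarrow> N (sym_diff P Q) < b \<Longrightarrow> Q \<in> V"
      using V P by (metis IntD2)
    show "\<exists>e>0. \<forall>Q\<in>Fpow Y. N (sym_diff P Q) < e \<longrightarrow> Q \<in> U \<inter> V"
      by (rule exI[of _ "min a b"]) (use a b in simp)
  next
    fix \<U> P
    assume "\<forall>U\<in>\<U>. U \<subseteq> Fpow Y \<and> (\<forall>P\<in>U. \<exists>e>0. \<forall>Q\<in>Fpow Y. N (sym_diff P Q) < e \<longrightarrow> Q \<in> U)"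
      and "P \<in> \<Union>\<U>"
    then show "\<exists>e>0. \<forall>Q\<in>Fpow Y. N (sym_diff P Q) < e \<longrightarrow> Q \<in> \<Union>\<U>"
      by (metis Union_iff)
  qed blast+
  then have op: "openin S U \<longleftrightarrow>
           U \<subseteq> Fpow Y \<and> (\<forall>P\<in>U. \<exists>e>0. \<forall>Q\<in>Fpow Y. N (sym_diff P Q) < e \<longrightarrow> Q \<in> U)" for U
    by (simp add: S_def)
  have ball: "openin S {Q \<in> Fpow Y. N (sym_diff P Q) < e}" if P: "P \<in> Fpow Y" for P e
    unfolding op
  proof (intro conjI ballI)
    fix Q assume "Q \<in> {Q \<in> Fpow Y. N (sym_diff P Q) < e}"
    then have Q: "Q \<in> Fpow Y" "N (sym_diff P Q) < e" by auto
    have "N (sym_diff P R) < e" if R: "R \<in> Fpow Y" "N (sym_diff Q R) < e - N (sym_diff P Q)" for R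
    proof -
      have "sym_diff P R = sym_diff (sym_diff P Q) (sym_diff Q R)" by auto
      then have "N (sym_diff P R) \<le> N (sym_diff P Q) + N (sym_diff Q R)"
        using Ntri[OF sym_diff_Fpow[OF P Q(1)] sym_diff_Fpow[OF Q(1) R(1)]] by simp
      then show ?thesis using R(2) by simp
    qed
    then show "\<exists>d>0. \<forall>R\<in>Fpow Y. N (sym_diff Q R) < d \<longrightarrow> R \<in> {Q \<in> Fpow Y. N (sym_diff P Q) < e}"
      using Q(2) by (intro exI[of _ "e - N (sym_diff P Q)"]) simp
  qed auto
  have top: "topspace S = Fpow Y"
  proof
    show "topspace S \<subseteq> Fpow Y" using op[of "topspace S"] by blast
    have "openin S (Fpow Y)" unfolding op by (auto intro: exI[of _ 1])
    then show "Fpow Y \<subseteq> topspace S" by (rule openin_subset)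
  qed
  have "continuous_map (prod_topology S S) S (\<lambda>(P, Q). sym_diff P Q)"
    unfolding continuous_map_def
  proof (intro conjI allI impI)
    show "(\<lambda>(P, Q). sym_diff P Q) \<in> topspace (prod_topology S S) \<rightarrow> topspace S"
      by (auto simp: top Fpow_def)
    fix U assume U: "openin S U"
    show "openin (prod_topology S S)
            {x \<in> topspace (prod_topology S S). (case x of (P, Q) \<Rightarrow> sym_diff P Q) \<in> U}"
    proof (subst openin_subopen, intro ballI)
      fix z assume "z \<in> {x \<in> topspace (prod_topology S S). (case x of (P, Q) \<Rightarrow> sym_diff P Q) \<in> U}"
      then obtain P Q where z: "z = (P, Q)" "P \<in> Fpow Y" "Q \<in> Fpow Y" "sym_diff P Q \<in> U"
        by (auto simp: top)
      obtain e where e: "e > 0" "\<And>R. R \<in> Fpow Y \<Longrightarrow> N (sym_diff (sym_diff P Q) R) < e \<Longrightarrow> R \<in> U"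
        using U z(4) unfolding op by metis
      let ?A = "{R \<in> Fpow Y. N (sym_diff P R) < e / 2}" and ?B = "{R \<in> Fpow Y. N (sym_diff Q R) < e / 2}"
      have "sym_diff P' Q' \<in> U" if P': "P' \<in> ?A" and Q': "Q' \<in> ?B" for P' Q'
      proof (rule e(2))
        have eq: "sym_diff (sym_diff P Q) (sym_diff P' Q') = sym_diff (sym_diff P P') (sym_diff Q Q')"
          by auto
        have "N (sym_diff (sym_diff P Q) (sym_diff P' Q')) \<le> N (sym_diff P P') + N (sym_diff Q Q')"
          unfolding eq using z P' Q' by (intro Ntri sym_diff_Fpow) auto
        then show "N (sym_diff (sym_diff P Q) (sym_diff P' Q')) < e"
          using P' Q' by simp
      qed (use P' Q' in \<open>auto intro: sym_diff_Fpow\<close>)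
      moreover have "openin (prod_topology S S) (?A \<times> ?B)"
        using ball[OF z(2), of "e / 2"] ball[OF z(3), of "e / 2"]
        unfolding openin_prod_Times_iff by blast
      moreover have "z \<in> ?A \<times> ?B"
        using z e(1) N0 by simp
      ultimately show "\<exists>T. openin (prod_topology S S) T \<and> z \<in> T \<and>
          T \<subseteq> {x \<in> topspace (prod_topology S S). (case x of (P, Q) \<Rightarrow> sym_diff P Q) \<in> U}"
        by (intro exI[of _ "?A \<times> ?B"]) (auto simp: top)
    qed
  qed
  then have "boolean_topological_group (fin_sets_group Y) S"
    using top by (rule boolean_fin_sets_groupI[rotated])
  then show ?thesis using that op ball by blast
qed

lemma odd_card_sym_diff:
  assumes "finite P" "finite Q"
  shows "odd (card (sym_diff P Q)) \<longleftrightarrow> odd (card P) \<noteq> odd (card Q)"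
proof -
  have "card (sym_diff P Q) = card (P - Q) + card (Q - P)"
    using assms by (intro card_Un_disjoint) auto
  moreover have "card P = card (P - Q) + card (P \<inter> Q)" "card Q = card (Q - P) + card (P \<inter> Q)"
    using assms by (metis card_Diff_subset_Int card_Int_Diff add.commute finite_Int inf_commute)+
  ultimately show ?thesis by auto
qed

lemma boolean_seminorm_exists:
  fixes f :: "'x \<Rightarrow> real"
  assumes f: "\<And>y. y \<in> Y \<Longrightarrow> 0 \<le> f y \<and> f y \<le> 1"
  obtains N :: "'x set \<Rightarrow> real" where "N {} = 0"
    and "\<And>P Q. P \<in> Fpow Y \<Longrightarrow> Q \<in> Fpow Y \<Longrightarrow> N (sym_diff P Q) \<le> N P + N Q"
    and "\<And>y z. y \<in> Y \<Longrightarrow> z \<in> Y \<Longrightarrow> N (sym_diff {y} {z}) = \<bar>f y - f z\<bar>"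
proof -
  define E where "E P = {t \<in> {0..1::real}. odd (card {y \<in> P. t \<le> f y})}" for P
  define N where "N P = measure lebesgue (E P)" for P
  have E_sym_diff: "E (sym_diff P Q) = sym_diff (E P) (E Q)" if "finite P" "finite Q" for P Q
  proof -
    have "{y \<in> sym_diff P Q. t \<le> f y} = sym_diff {y \<in> P. t \<le> f y} {y \<in> Q. t \<le> f y}" for t
      by auto
    then show ?thesis
      using that by (auto simp: E_def odd_card_sym_diff)
  qed
  have E_single: "E {y} = {0..f y}" if "y \<in> Y" for y
  proof -
    have "{z \<in> {y}. t \<le> f z} = (if t \<le> f y then {y} else {})" for t by auto
    then show ?thesis using f[OF that] by (auto simp: E_def split: if_splits)
  qed
  have meas: "E P \<in> lmeasurable" if "finite P" "P \<subseteq> Y" for P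
    using that
  proof (induction P rule: finite_induct)
    case empty
    then show ?case by (simp add: E_def)
  next
    case (insert y P)
    then have "E (sym_diff {y} P) \<in> lmeasurable"
      by (subst E_sym_diff) (auto simp: E_single intro!: fmeasurable.Un fmeasurable.Diff)
    moreover have "sym_diff {y} P = insert y P" using insert by auto
    ultimately show ?case by simp
  qed
  show ?thesis
  proof
    show "N {} = 0" by (simp add: N_def E_def)
    show "N (sym_diff P Q) \<le> N P + N Q" if "P \<in> Fpow Y" "Q \<in> Fpow Y" for P Q
    proof -
      have PQ: "finite P" "P \<subseteq> Y" "finite Q" "Q \<subseteq> Y" using that by (auto simp: Fpow_def)
      have "measure lebesgue (sym_diff (E P) (E Q)) \<le> measure lebesgue (E P \<union> E Q)"
        using PQ meas by (intro measure_mono_fmeasurable) (auto intro: fmeasurableD)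
      also have "\<dots> \<le> measure lebesgue (E P) + measure lebesgue (E Q)"
        using PQ meas by (intro measure_Un_le) (auto intro: fmeasurableD)
      finally show ?thesis using PQ by (simp add: N_def E_sym_diff)
    qed
    show "N (sym_diff {y} {z}) = \<bar>f y - f z\<bar>" if "y \<in> Y" "z \<in> Y" for y z
    proof -
      have *: "sym_diff {0..f y} {0..f z} = {min (f y) (f z)<..max (f y) (f z)}"
        using f[OF that(1)] f[OF that(2)] by (auto simp: min_def max_def)
      have "N (sym_diff {y} {z}) = measure lebesgue (sym_diff (E {y}) (E {z}))"
        unfolding N_def by (subst E_sym_diff) auto
      then show ?thesis
        unfolding E_single[OF that(1)] E_single[OF that(2)] * by (auto simp: min_def max_def)
    qed
  qed
qed


lemma boolean_fin_sets_group_pullback: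
  assumes H: "boolean_topological_group H S" and g: "g \<in> hom (fin_sets_group Y) H"
  shows "boolean_topological_group (fin_sets_group Y) (pullback_topology (Fpow Y) g S)"
proof (rule boolean_fin_sets_groupI)
  let ?S = "pullback_topology (Fpow Y) g S"
  have mult: "continuous_map (prod_topology S S) S (\<lambda>(x, y). x \<otimes>\<^bsub>H\<^esub> y)" and "topspace S = carrier H"
    using H by (auto simp: boolean_topological_group_def topological_group_def group_with_topology_def)
  then show top: "topspace ?S = Fpow Y"
    using g by (auto simp: topspace_pullback_topology hom_def)
  have "continuous_map ?S S (g \<circ> (\<lambda>x. x))"
    using continuous_map_pullback[of S S id "Fpow Y" g] by (simp add: o_def)
  then have "continuous_map (prod_topology ?S ?S) (prod_topology S S) (\<lambda>(P, Q). (g P, g Q))"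
    by (simp add: continuous_map_prod_top o_def)
  from continuous_map_compose[OF this mult]
  have "continuous_map (prod_topology ?S ?S) S (g \<circ> (\<lambda>(P, Q). sym_diff P Q))"
    by (rule continuous_map_eq) (use hom_mult[OF g] in \<open>auto simp: top\<close>)
  then show "continuous_map (prod_topology ?S ?S) ?S (\<lambda>(P, Q). sym_diff P Q)"
    by (rule continuous_map_pullback') (unfold topspace_prod_topology top, auto simp: Fpow_def)
qed

lemma continuous_map_into_sup:
  assumes "g \<in> topspace Z \<rightarrow> \<Union>{U. \<exists>S\<in>\<S>. openin S U}"
    and "\<And>S. S \<in> \<S> \<Longrightarrow> continuous_map Z S g"
  shows "continuous_map Z (topology_generated_by {U. \<exists>S\<in>\<S>. openin S U}) g"
proof (rule continuous_on_generated_topo)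
  fix U assume "U \<in> {U. \<exists>S\<in>\<S>. openin S U}"
  then obtain S where S: "S \<in> \<S>" "openin S U" by auto
  have "g -` U \<inter> topspace Z = {x \<in> topspace Z. g x \<in> U}" by auto
  then show "openin Z (g -` U \<inter> topspace Z)"
    using openin_continuous_map_preimage[OF assms(2)[OF S(1)] S(2)] by simp
qed (use assms(1) in auto)

theorem free_boolean_topological_group_exists:
  fixes X :: "'x topology"
  assumes X: "completely_regular_space X"
  shows "\<exists>T. free_boolean_topological_group X (fin_sets_group (topspace X)) T (\<lambda>x. {x})"
proof -
  define Y where "Y = topspace X"
  define \<S> where "\<S> = {S. boolean_topological_group (fin_sets_group Y) S \<and> continuous_map X S (\<lambda>x. {x})}"
  define T where "T = topology_generated_by {U. \<exists>S\<in>\<S>. openin S U}"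
  have topS: "topspace S = Fpow Y" if "S \<in> \<S>" for S
    using that boolean_fin_sets_groupD(1) by (auto simp: \<S>_def)
  have openT: "openin T U" if "S \<in> \<S>" "openin S U" for S U
    unfolding T_def by (rule topology_generated_by_Basis) (use that in auto)
  obtain S0 where S0: "S0 \<in> \<S>"
  proof -
    obtain S where S: "boolean_topological_group (fin_sets_group Y) S"
      "\<And>U. openin S U \<longleftrightarrow>
           U \<subseteq> Fpow Y \<and> (\<forall>P\<in>U. \<exists>e>0::real. \<forall>Q\<in>Fpow Y. (0::real) < e \<longrightarrow> Q \<in> U)"
      by (rule boolean_seminorm_topology[of "\<lambda>_. 0" Y]) auto
    have "continuous_map X S (\<lambda>x. {x})"
      unfolding continuous_map_def
    proof (intro conjI allI impI)
      show "(\<lambda>x. {x}) \<in> topspace X \<rightarrow> topspace S"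
        by (auto simp: boolean_fin_sets_groupD(1)[OF S(1)] Y_def Fpow_def)
      fix U assume "openin S U"
      then have "U \<subseteq> Fpow Y" "U \<noteq> {} \<Longrightarrow> Fpow Y \<subseteq> U"
        unfolding S(2) by (blast, metis ex_in_conv subsetI)
      then have "U = {} \<or> U = Fpow Y" by blast
      then have "{x \<in> topspace X. {x} \<in> U} = {} \<or> {x \<in> topspace X. {x} \<in> U} = topspace X"
        by (auto simp: Y_def Fpow_def)
      then show "openin X {x \<in> topspace X. {x} \<in> U}"
        by (elim disjE) (simp_all only: openin_empty openin_topspace)
    qed
    then show thesis using that S(1) by (auto simp: \<S>_def)
  qed
  have gen: "\<Union>{U. \<exists>S\<in>\<S>. openin S U} = Fpow Y"
  proof
    show "\<Union>{U. \<exists>S\<in>\<S>. openin S U} \<subseteq> Fpow Y"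
      using topS openin_subset by fastforce
    show "Fpow Y \<subseteq> \<Union>{U. \<exists>S\<in>\<S>. openin S U}"
      using S0 topS[OF S0] openin_topspace[of S0] by blast
  qed
  then have topT: "topspace T = Fpow Y"
    by (simp add: T_def topology_generated_by_topspace)
  have from_T: "continuous_map T S (\<lambda>P. P)" if "S \<in> \<S>" for S
    unfolding continuous_map_def
  proof (intro conjI allI impI)
    fix U assume U: "openin S U"
    then have "{P \<in> topspace T. P \<in> U} = U"
      using openin_subset[OF U] by (auto simp: topT topS[OF that])
    then show "openin T {P \<in> topspace T. P \<in> U}" using openT[OF that U] by simp
  qed (auto simp: topT topS[OF that])
  have cont: "continuous_map X T (\<lambda>x. {x})"
    unfolding T_def using gen
    by (intro continuous_map_into_sup) (auto simp: \<S>_def Y_def Fpow_def)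
  have boolT: "boolean_topological_group (fin_sets_group Y) T"
  proof (rule boolean_fin_sets_groupI[OF topT], unfold T_def, rule continuous_map_into_sup, fold T_def)
    show "(\<lambda>(P, Q). sym_diff P Q) \<in> topspace (prod_topology T T) \<rightarrow> \<Union>{U. \<exists>S\<in>\<S>. openin S U}"
      unfolding gen by (auto simp: topT Fpow_def)
    fix S assume S: "S \<in> \<S>"
    then have mult: "continuous_map (prod_topology S S) S (\<lambda>(P, Q). sym_diff P Q)"
      using boolean_fin_sets_groupD(2) by (auto simp: \<S>_def)
    have "continuous_map (prod_topology T T) (prod_topology S S) (\<lambda>(P, Q). (P, Q))"
      using from_T[OF S] continuous_map_prod_top[of T T S S "\<lambda>P. P" "\<lambda>P. P"] by simp
    from continuous_map_compose[OF this mult]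
    show "continuous_map (prod_topology T T) S (\<lambda>(P, Q). sym_diff P Q)"
      by (simp add: o_def case_prod_unfold)
  qed
  have emb: "embedding_map X T (\<lambda>x. {x})"
    unfolding embedding_map_def
  proof (rule bijective_open_imp_homeomorphic_map)
    show "continuous_map X (subtopology T ((\<lambda>x. {x}) ` topspace X)) (\<lambda>x. {x})"
      using cont by (simp add: continuous_map_in_subtopology)
    show "(\<lambda>x. {x}) ` topspace X = topspace (subtopology T ((\<lambda>x. {x}) ` topspace X))"
      by (auto simp: topT Y_def Fpow_def)
    show "inj_on (\<lambda>x. {x}) (topspace X)" by (auto simp: inj_on_def)
    show "open_map X (subtopology T ((\<lambda>x. {x}) ` topspace X)) (\<lambda>x. {x})"
      unfolding open_map_def
    proof (intro allI impI)
      fix U assume U: "openin X U"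
      have "\<exists>V. openin T V \<and> {x} \<in> V \<and> (\<forall>z\<in>topspace X. {z} \<in> V \<longrightarrow> z \<in> U)" if x: "x \<in> U" for x
      proof -
        have "closedin X (topspace X - U)" "x \<in> topspace X - (topspace X - U)"
          using U x openin_subset by blast+
        then obtain f :: "'x \<Rightarrow> real" where f: "continuous_map X (top_of_set {0..1}) f" "f x = 0"
            "f ` (topspace X - U) \<subseteq> {1}"
          using X unfolding completely_regular_space_def by meson
        have f01: "0 \<le> f y \<and> f y \<le> 1" if "y \<in> Y" for y
          using f(1) that by (auto simp: continuous_map_def Y_def Pi_iff)
        obtain N :: "'x set \<Rightarrow> real" where N: "N {} = 0"
            "\<And>P Q. P \<in> Fpow Y \<Longrightarrow> Q \<in> Fpow Y \<Longrightarrow> N (sym_diff P Q) \<le> N P + N Q"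
            "\<And>y z. y \<in> Y \<Longrightarrow> z \<in> Y \<Longrightarrow> N (sym_diff {y} {z}) = \<bar>f y - f z\<bar>"
          using boolean_seminorm_exists[of Y f] f01 by blast
        obtain S where S: "boolean_topological_group (fin_sets_group Y) S"
            "\<And>U. openin S U \<longleftrightarrow>
               U \<subseteq> Fpow Y \<and> (\<forall>P\<in>U. \<exists>e>0. \<forall>Q\<in>Fpow Y. N (sym_diff P Q) < e \<longrightarrow> Q \<in> U)"
            "\<And>P e. P \<in> Fpow Y \<Longrightarrow> openin S {Q \<in> Fpow Y. N (sym_diff P Q) < e}"
          using boolean_seminorm_topology[of N Y, OF N(1,2)] by blast
        have "continuous_map X S (\<lambda>x. {x})"
          unfolding continuous_map_def
        proof (intro conjI allI impI)
          show "(\<lambda>x. {x}) \<in> topspace X \<rightarrow> topspace S"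
            by (auto simp: boolean_fin_sets_groupD(1)[OF S(1)] Y_def Fpow_def)
          fix V assume V: "openin S V"
          show "openin X {x \<in> topspace X. {x} \<in> V}"
          proof (subst openin_subopen, intro ballI)
            fix y assume "y \<in> {x \<in> topspace X. {x} \<in> V}"
            then have y: "y \<in> Y" "{y} \<in> V" by (auto simp: Y_def)
            obtain e where e: "e > 0" "\<And>Q. Q \<in> Fpow Y \<Longrightarrow> N (sym_diff {y} Q) < e \<Longrightarrow> Q \<in> V"
              using V y(2) unfolding S(2) by blast
            have fR: "continuous_map X euclideanreal f"
              using f(1) by (simp add: continuous_map_in_subtopology)
            have "openin X {z \<in> topspace X. f z \<in> ball (f y) e}"
              by (rule openin_continuous_map_preimage[OF fR]) simp
            moreover have "{z} \<in> V" if z: "z \<in> topspace X" "f z \<in> ball (f y) e" for z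
            proof (rule e(2))
              show "N (sym_diff {y} {z}) < e"
                using z y N(3)[of y z] by (simp add: Y_def dist_real_def)
            qed (use z in \<open>simp add: Y_def Fpow_def\<close>)
            ultimately show "\<exists>W. openin X W \<and> y \<in> W \<and> W \<subseteq> {x \<in> topspace X. {x} \<in> V}"
              using y e(1) by (intro exI[of _ "{z \<in> topspace X. f z \<in> ball (f y) e}"]) (auto simp: Y_def)
          qed
        qed
        then have S_in: "S \<in> \<S>" using S(1) by (simp add: \<S>_def)
        have xY: "x \<in> Y" using x U openin_subset by (auto simp: Y_def)
        show ?thesis
        proof (intro exI conjI ballI impI)
          show "openin T {Q \<in> Fpow Y. N (sym_diff {x} Q) < 1}"
            using xY by (intro openT[OF S_in] S(3)) (simp add: Fpow_def)
          show "{x} \<in> {Q \<in> Fpow Y. N (sym_diff {x} Q) < 1}"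
            using xY N(1) by (simp add: Fpow_def)
          show "z \<in> U" if "z \<in> topspace X" "{z} \<in> {Q \<in> Fpow Y. N (sym_diff {x} Q) < 1}" for z
          proof (rule ccontr)
            assume "z \<notin> U"
            then have "f z = 1" using f(3) that(1) by auto
            then show False using that N(3)[OF xY, of z] f(2) by (simp add: Y_def)
          qed
        qed
      qed
      then obtain V where V: "\<And>x. x \<in> U \<Longrightarrow> openin T (V x) \<and> {x} \<in> V x \<and> (\<forall>z\<in>topspace X. {z} \<in> V x \<longrightarrow> z \<in> U)"
        by metis
      have "(\<lambda>x. {x}) ` U = (\<Union>x\<in>U. V x) \<inter> (\<lambda>x. {x}) ` topspace X"
        using V openin_subset[OF U] by blast
      moreover have "openin T (\<Union>x\<in>U. V x)"
        using V by (intro openin_Union) auto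
      ultimately show "openin (subtopology T ((\<lambda>x. {x}) ` topspace X)) ((\<lambda>x. {x}) ` U)"
        by (auto simp: openin_subtopology)
    qed
  qed
  have univ: "\<exists>g. g \<in> hom (fin_sets_group Y) H \<and> continuous_map T S g \<and> (\<forall>x\<in>topspace X. g {x} = f x)"
    if H: "boolean_topological_group H S" and f: "continuous_map X S f" for H :: "'x set monoid" and S f
  proof -
    have gH: "group H" and boole: "\<forall>x\<in>carrier H. x \<otimes>\<^bsub>H\<^esub> x = \<one>\<^bsub>H\<^esub>" and topSH: "topspace S = carrier H"
      using H by (auto simp: boolean_topological_group_def topological_group_def group_with_topology_def)
    interpret H: comm_group H
      by (rule boolean_comm_group[OF gH boole])
    have fX: "f \<in> Y \<rightarrow> carrier H"
      using f topSH by (auto simp: continuous_map_def Y_def)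
    define g where "g = finprod H f"
    have hom: "g \<in> hom (fin_sets_group Y) H"
    proof (rule homI)
      show "g P \<in> carrier H" if "P \<in> carrier (fin_sets_group Y)" for P
        unfolding g_def using that fX by (intro H.finprod_closed) (auto simp: Fpow_def)
      show "g (P \<otimes>\<^bsub>fin_sets_group Y\<^esub> Q) = g P \<otimes>\<^bsub>H\<^esub> g Q"
        if "P \<in> carrier (fin_sets_group Y)" "Q \<in> carrier (fin_sets_group Y)" for P Q
        using that by (simp add: g_def Fpow_def
            boolean_finprod_sym_diff[OF H.comm_group_axioms boole fX])
    qed
    have g1: "g {x} = f x" if "x \<in> topspace X" for x
    proof -
      have "f x \<in> carrier H" using that fX by (auto simp: Y_def)
      then show ?thesis by (simp add: g_def)
    qed
    let ?P = "pullback_topology (Fpow Y) g S"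
    have "continuous_map X S (g \<circ> (\<lambda>x. {x}))"
      by (rule continuous_map_eq[OF f]) (simp add: g1)
    then have "continuous_map X ?P (\<lambda>x. {x})"
      by (rule continuous_map_pullback') (auto simp: Y_def Fpow_def)
    then have "?P \<in> \<S>"
      using boolean_fin_sets_group_pullback[OF H hom] by (simp add: \<S>_def)
    moreover have "continuous_map ?P S g"
      using continuous_map_pullback[of S S id "Fpow Y" g] by simp
    ultimately have "continuous_map T S g"
      using continuous_map_compose[OF from_T] by (force simp: o_def)
    then show ?thesis using hom g1 by blast
  qed
  show ?thesis
    unfolding free_boolean_topological_group_def Y_def[symmetric]
    using boolT emb generate_fin_sets_group[of Y] univ by (intro exI[of _ T]) (simp add: Y_def[symmetric])
qed

end

theory Submission
  imports Defs "HOL-Algebra.Free_Abelian_Groups"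
begin

text \<open>Every \<open>M \<alpha>\<close> meets every interval, for otherwise \<open>\<real>\<^bsub>[M \<alpha>]\<^esub>\<close> would contain an uncountable closed
  discrete interval. Hence \<open>L\<close> and \<open>R\<close> are zero-dimensional: points of \<open>B\<close> cut \<open>L\<close> (and points of \<open>A\<close>
  cut \<open>R\<close>) into a binary tree of clopen cells. The key point is that, for each of the topologies
  involved, \<open>X\<close> is a retract of \<open>B(X)\<close>: a finite set \<open>P\<close> of odd size is sent to the leftmost point
  of \<open>P\<close> all of whose cells meet \<open>P\<close> in an odd number of points. Continuity only uses that, for a
  clopen partition of \<open>X\<close>, the parities of a word on the parts are locally constant on \<open>B(X)\<close>.

  For retractions \<open>r\<close>, \<open>s\<close> of the two factors, \<open>{r g \<le> s h}\<close> is clopen in the product, since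
  equality can only occur at points of \<open>C\<close>, where suitable half-lines are open. Its indicator is not
  factorizable over a countable network: \<open>c \<le> c'\<close> would be decided by open sets in a space
  with a countable network, which injects \<open>C\<close> into the network. The diagonal over \<open>C\<close> is closed
  discrete, giving the extent and, by Jones' lemma, non-normality; if points of \<open>C\<close> are isolated,
  then \<open>{r g = s h = c}\<close> is a discrete family of open sets.\<close>

section \<open>Odd branches in a tree of cells\<close>

locale cuts =
  fixes L :: "real set" and b :: "nat \<Rightarrow> real"
  assumes b_notin: "b n \<notin> L"
    and b_between: "u < v \<Longrightarrow> \<exists>n. u < b n \<and> b n < v"
begin

text \<open>A code for an interval of the line cut at the first \<open>n\<close> points: two points
  share a cell of level \<open>n\<close> iff their codes agree. Level 0 is a single cell, and since
  \<open>b\<close> may repeat values a cell need not split at the next level.\<close>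

definition cell :: "nat \<Rightarrow> real \<Rightarrow> nat set" where
  "cell n x = {i. i < n \<and> b i < x}"

lemma cell_eq_iff: "cell n x = cell n y \<longleftrightarrow> (\<forall>i<n. b i < x \<longleftrightarrow> b i < y)"
  by (auto simp: cell_def)

lemma cell_Suc_eq_iff:
  "cell (Suc n) x = cell (Suc n) y \<longleftrightarrow> cell n x = cell n y \<and> (b n < x \<longleftrightarrow> b n < y)"
  by (auto simp: cell_eq_iff less_Suc_eq)

lemma cell_eq_antimono: "cell n x = cell n y \<Longrightarrow> m \<le> n \<Longrightarrow> cell m x = cell m y"
  by (auto simp: cell_eq_iff)

text \<open>Cells of one level are convex, so distinct ones are linearly ordered: a cut between
  \<open>x\<close> and \<open>y\<close> also lies between any two points sharing their
  cells.\<close>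

lemma cell_less:
  assumes "cell n x' = cell n x" "cell n y' = cell n y" "cell n x \<noteq> cell n y" "x < y"
  shows "x' < y'"
proof -
  obtain i where "i < n" "\<not> b i < x" "b i < y"
    using assms(3,4) by (auto simp: cell_eq_iff)
  then show ?thesis
    using assms(1,2) unfolding cell_eq_iff by (meson le_less_trans not_less)
qed

lemma separated:
  assumes "x \<noteq> y" shows "\<exists>i. (b i < x) \<noteq> (b i < y)"
proof (cases "x < y")
  case True
  then show ?thesis using b_between[of x y] by (meson less_asym)
next
  case False
  then show ?thesis using assms b_between[of y x] by (meson less_asym linorder_less_linear)
qed

lemma eventually_cell_separates:
  assumes "x \<noteq> y" shows "\<forall>\<^sub>F n in sequentially. cell n x \<noteq> cell n y"
proof -
  obtain i where "(b i < x) \<noteq> (b i < y)" using separated[OF assms] by blast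
  then show ?thesis
    unfolding eventually_sequentially by (intro exI[of _ "Suc i"]) (auto simp: cell_eq_iff Suc_le_eq)
qed

lemma eventually_cell_isolates:
  assumes "finite P"
  shows "\<forall>\<^sub>F n in sequentially. \<forall>y\<in>P. cell n y = cell n x \<longrightarrow> y = x"
proof (rule eventually_ball_finite[OF assms], rule ballI)
  fix y
  show "\<forall>\<^sub>F n in sequentially. cell n y = cell n x \<longrightarrow> y = x"
    by (cases "y = x") (use eventually_cell_separates[of y x] in \<open>auto elim: eventually_mono\<close>)
qed

definition odd_branch :: "real set \<Rightarrow> real \<Rightarrow> bool" where
  "odd_branch P x \<longleftrightarrow> x \<in> P \<and> (\<forall>n. odd (card {y \<in> P. cell n y = cell n x}))"

text \<open>An odd cell splits into two cells, exactly one of which is odd again.\<close>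

lemma odd_cell_contains_odd_branch:
  assumes P: "finite P" and odd: "odd (card {y \<in> P. cell n y = cell n x})"
  shows "\<exists>y\<in>P. cell n y = cell n x \<and> (\<forall>m\<ge>n. odd (card {z \<in> P. cell m z = cell m y}))"
proof -
  \<comment> \<open>The witness \<open>y\<close> may change with \<open>j\<close>, as each step
    moves to the odd half of its cell; a single \<open>y\<close> for all levels is extracted
    afterwards.\<close>
  have *: "\<exists>y\<in>P. cell n y = cell n x \<and>
      (\<forall>m. n \<le> m \<and> m \<le> n + j \<longrightarrow> odd (card {z \<in> P. cell m z = cell m y}))" for j
  proof (induction j)
    case 0
    from odd have "{y \<in> P. cell n y = cell n x} \<noteq> {}" by (metis card.empty even_zero)
    then show ?case using odd by auto
  next
    case (Suc j)
    then obtain y where y: "y \<in> P" "cell n y = cell n x"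
      and yodd: "\<And>m. n \<le> m \<Longrightarrow> m \<le> n + j \<Longrightarrow> odd (card {z \<in> P. cell m z = cell m y})"
      by blast
    define Q where "Q = {z \<in> P. cell (n + j) z = cell (n + j) y}"
    have "Q = {z \<in> Q. b (n + j) < z} \<union> {z \<in> Q. \<not> b (n + j) < z}" by auto
    moreover have "finite Q" using P by (simp add: Q_def)
    ultimately have "card Q = card {z \<in> Q. b (n + j) < z} + card {z \<in> Q. \<not> b (n + j) < z}"
      by (subst card_Un_disjoint[symmetric]) auto
    moreover have "odd (card Q)" unfolding Q_def by (rule yodd) auto
    \<comment> \<open>Writing both halves as fibres of \<open>b (n + j) < z\<close> lets one boolean
      \<open>s\<close> stand for the odd one.\<close>
    ultimately have "odd (card {z \<in> Q. (b (n + j) < z) = True}) \<or> odd (card {z \<in> Q. (b (n + j) < z) = False})"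
      by simp
    then obtain s where s: "odd (card {z \<in> Q. (b (n + j) < z) = s})" by blast
    then have "{z \<in> Q. (b (n + j) < z) = s} \<noteq> {}" by (intro notI) simp
    then obtain y' where y': "y' \<in> Q" "(b (n + j) < y') = s" by blast
    have eq: "{z \<in> P. cell (Suc (n + j)) z = cell (Suc (n + j)) y'} = {z \<in> Q. (b (n + j) < z) = s}"
      using y' by (auto simp: Q_def cell_Suc_eq_iff)
    have cells: "cell m y' = cell m y" if "m \<le> n + j" for m
      by (rule cell_eq_antimono[OF _ that]) (use y'(1) in \<open>simp add: Q_def\<close>)
    have "odd (card {z \<in> P. cell m z = cell m y'})" if "n \<le> m" "m \<le> n + Suc j" for m
    proof (cases "m \<le> n + j")
      case True
      then show ?thesis using cells yodd that by simp
    next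
      case False
      then have "m = Suc (n + j)" using that by simp
      then show ?thesis using eq s by simp
    qed
    moreover have "y' \<in> P" "cell n y' = cell n x"
      using y'(1) cells[of n] y(2) by (auto simp: Q_def)
    ultimately show ?case by blast
  qed
  \<comment> \<open>From some level on the cells separate the points of \<open>P\<close>, so oddness
    there is automatic and finitely many levels suffice.\<close>
  have "\<forall>\<^sub>F m in sequentially. \<forall>y\<in>P. \<forall>z\<in>P. cell m z = cell m y \<longrightarrow> z = y"
    by (rule eventually_ball_finite[OF P], rule ballI, rule eventually_cell_isolates[OF P])
  then obtain N where N: "\<And>m y z. N \<le> m \<Longrightarrow> y \<in> P \<Longrightarrow> z \<in> P \<Longrightarrow> cell m z = cell m y \<Longrightarrow> z = y"
    unfolding eventually_sequentially by blast
  from *[of N] obtain y where y: "y \<in> P" "cell n y = cell n x"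
    and yodd: "\<forall>m. n \<le> m \<and> m \<le> n + N \<longrightarrow> odd (card {z \<in> P. cell m z = cell m y})"
    by (elim bexE conjE)
  have "odd (card {z \<in> P. cell m z = cell m y})" if "n \<le> m" for m
  proof (cases "m \<le> n + N")
    case False
    then have "{z \<in> P. cell m z = cell m y} = {y}" using N[of m y] y(1) by auto
    then show ?thesis by simp
  next
    case True
    then show ?thesis using yodd that by simp
  qed
  then show ?thesis using y by blast
qed

text \<open>A set of even size has no odd branch, level 0 being even, and goes to the default
  \<open>x\<^sub>0\<close>. This is harmless for continuity because the parity of the support is
  locally constant.\<close>

definition select :: "real \<Rightarrow> real set \<Rightarrow> real" where
  "select x\<^sub>0 P = (if odd (card P) then Min {x. odd_branch P x} else x\<^sub>0)"

lemma odd_branch_select: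
  assumes "finite P" "odd (card P)"
  shows "odd_branch P (select x\<^sub>0 P)" "odd_branch P x \<Longrightarrow> select x\<^sub>0 P \<le> x"
proof -
  have "{x. odd_branch P x} \<subseteq> P" by (auto simp: odd_branch_def)
  then have fin: "finite {x. odd_branch P x}" using assms(1) finite_subset by blast
  \<comment> \<open>The only cell of level 0 meets \<open>P\<close> in all of \<open>P\<close>, so a
    branch starts there.\<close>
  have "odd (card {y \<in> P. cell 0 y = cell 0 x\<^sub>0})" using assms(2) by (simp add: cell_def)
  from odd_cell_contains_odd_branch[OF assms(1) this] have "{x. odd_branch P x} \<noteq> {}"
    by (auto simp: odd_branch_def)
  with fin have "Min {x. odd_branch P x} \<in> {x. odd_branch P x}" by (rule Min_in)
  then show "odd_branch P (select x\<^sub>0 P)" using assms(2) by (simp add: select_def)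
  show "select x\<^sub>0 P \<le> x" if "odd_branch P x" using that fin assms(2) by (simp add: select_def)
qed

lemma select_in: "finite P \<Longrightarrow> P \<subseteq> L \<Longrightarrow> x\<^sub>0 \<in> L \<Longrightarrow> select x\<^sub>0 P \<in> L"
  using odd_branch_select(1) by (cases "odd (card P)") (auto simp: odd_branch_def select_def)

lemma select_singleton [simp]: "select x\<^sub>0 {x} = x"
  using odd_branch_select(1)[of "{x}"] by (simp add: odd_branch_def)

text \<open>Beyond level \<open>n\<close> nothing is known about \<open>P\<close>, but the cell of
  \<open>x\<close> at level \<open>n\<close> is odd for \<open>P\<close> and so contains a point
  that stays odd at all later levels; the earlier levels are inherited from
  \<open>Q\<close>.\<close>

lemma odd_branch_transfer:
  assumes P: "finite P" and x: "odd_branch Q x"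
    and par: "\<And>k z. k \<le> n \<Longrightarrow> odd (card {y \<in> P. cell k y = cell k z}) = odd (card {y \<in> Q. cell k y = cell k z})"
  obtains x' where "odd_branch P x'" "cell n x' = cell n x"
proof -
  have "odd (card {y \<in> P. cell n y = cell n x})"
    using x par by (simp add: odd_branch_def)
  from odd_cell_contains_odd_branch[OF P this] obtain x' where x': "x' \<in> P" "cell n x' = cell n x"
    "\<And>m. n \<le> m \<Longrightarrow> odd (card {z \<in> P. cell m z = cell m x'})" by blast
  have "odd (card {z \<in> P. cell m z = cell m x'})" for m
  proof (cases "n \<le> m")
    case False
    then have "cell m x' = cell m x" using cell_eq_antimono[OF x'(2)] by simp
    then show ?thesis using x par[of m x] False by (simp add: odd_branch_def)
  qed (rule x'(3))
  then show thesis using that x' by (auto simp: odd_branch_def)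
qed

text \<open>Odd branches of \<open>P\<close> and \<open>Q\<close> pass through the same cells of
  level \<open>n\<close>. If the leftmost ones lay in different cells, the one further left could be
  transferred to the other set and would beat its minimum, by \<open>cell_less\<close>.\<close>

lemma select_cell_cong:
  assumes fin: "finite P" "finite Q" and P: "odd (card P)"
    and par: "\<And>k z. k \<le> n \<Longrightarrow> odd (card {y \<in> P. cell k y = cell k z}) = odd (card {y \<in> Q. cell k y = cell k z})"
  shows "cell n (select x\<^sub>0 Q) = cell n (select x\<^sub>0 P)"
proof (rule ccontr)
  let ?x = "select x\<^sub>0 P" and ?y = "select x\<^sub>0 Q"
  assume neq: "cell n ?y \<noteq> cell n ?x"
  have Q: "odd (card Q)" using P par[of 0] by (simp add: cell_def)
  obtain x' where x': "odd_branch Q x'" "cell n x' = cell n ?x"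
    by (rule odd_branch_transfer[OF fin(2) odd_branch_select(1)[OF fin(1) P], of n])
      (use par in auto)
  obtain y' where y': "odd_branch P y'" "cell n y' = cell n ?y"
    by (rule odd_branch_transfer[OF fin(1) odd_branch_select(1)[OF fin(2) Q], of n])
      (use par in auto)
  have "?y \<le> x'" "?x \<le> y'"
    using odd_branch_select(2) fin P Q x' y' by auto
  moreover have "?x < ?y \<or> ?y < ?x" using neq by auto
  ultimately show False
    using cell_less[OF x'(2) refl neq[symmetric]] cell_less[OF y'(2) refl neq] by force
qed

text \<open>The largest cell of \<open>y\<close> that does not contain \<open>x\<close>.\<close>

definition off_branch :: "real \<Rightarrow> real \<Rightarrow> real set" where
  "off_branch x y = (let n = Suc (LEAST i. (b i < x) \<noteq> (b i < y)) in {z \<in> L. cell n z = cell n y})"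

lemma off_branch_obtain:
  assumes "x \<noteq> y"
  obtains n where "cell n x = cell n y" "(b n < x) \<noteq> (b n < y)"
    "off_branch x y = {z \<in> L. cell (Suc n) z = cell (Suc n) y}"
proof
  let ?n = "LEAST i. (b i < x) \<noteq> (b i < y)"
  show "(b ?n < x) \<noteq> (b ?n < y)" using separated[OF assms] by (rule LeastI_ex)
  show "cell ?n x = cell ?n y" unfolding cell_eq_iff using not_less_Least by blast
qed (simp add: off_branch_def Let_def)

lemma in_off_branch_self: "y \<in> L \<Longrightarrow> y \<in> off_branch x y"
  by (simp add: off_branch_def Let_def)

text \<open>A point sharing the cell of \<open>y\<close> just after the first cut between
  \<open>x\<close> and \<open>y\<close> is first separated from \<open>x\<close> by that same cut.
  Hence the off-branches of \<open>x\<close> partition \<open>L - {x}\<close>.\<close>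

lemma off_branch_cong:
  assumes "x \<noteq> y" and z: "z \<in> off_branch x y" shows "z \<noteq> x" "off_branch x z = off_branch x y"
proof -
  obtain n where n: "cell n x = cell n y" "(b n < x) \<noteq> (b n < y)"
    "off_branch x y = {z \<in> L. cell (Suc n) z = cell (Suc n) y}"
    using off_branch_obtain[OF assms(1)] by blast
  have zn: "cell n z = cell n y" "(b n < z) = (b n < y)"
    using z n(3) by (auto simp: cell_Suc_eq_iff)
  then show "z \<noteq> x" using n(2) by auto
  have "(LEAST i. (b i < x) \<noteq> (b i < z)) = n"
  proof (rule Least_equality)
    show "(b n < x) \<noteq> (b n < z)" using n(2) zn by auto
    show "n \<le> i" if "(b i < x) \<noteq> (b i < z)" for i
      using that n(1) zn(1) by (metis cell_eq_iff not_less)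
  qed
  then show "off_branch x z = off_branch x y"
    using n(3) zn by (auto simp: off_branch_def Let_def cell_Suc_eq_iff)
qed

text \<open>If \<open>x\<close> and \<open>y\<close> still share a cell at level \<open>n\<close>,
  the first cut between them has index at least \<open>n\<close>, so the off-branch lies inside that
  cell.\<close>

lemma cell_off_branch:
  assumes "x \<noteq> y" "cell n y = cell n x" "z \<in> off_branch x y" shows "cell n z = cell n x"
proof -
  obtain m where m: "cell m x = cell m y" "(b m < x) \<noteq> (b m < y)"
    "off_branch x y = {z \<in> L. cell (Suc m) z = cell (Suc m) y}"
    using off_branch_obtain[OF assms(1)] by blast
  have "n \<le> m" using m(2) assms(2) by (metis cell_eq_iff not_less)
  then show ?thesis using assms(2,3) m(3) cell_eq_antimono[of "Suc m" z y n] by simp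
qed

text \<open>The last hypothesis puts all of \<open>W\<close> on the side of \<open>x\<close> of any
  cut between \<open>x\<close> and \<open>y\<close>, whereas the off-branch lies on the side of
  \<open>y\<close> of one such cut.\<close>

lemma off_branch_disjoint:
  assumes "y \<notin> W" "x \<in> W"
    and "\<And>i z. (b i < x) \<noteq> (b i < y) \<Longrightarrow> z \<in> W \<Longrightarrow> b i < z \<longleftrightarrow> b i < x"
  shows "off_branch x y \<inter> W = {}"
proof -
  have "x \<noteq> y" using assms(1,2) by auto
  from off_branch_obtain[OF this] obtain n where n: "(b n < x) \<noteq> (b n < y)"
    "off_branch x y = {z \<in> L. cell (Suc n) z = cell (Suc n) y}" .
  have "z \<notin> W" if "z \<in> off_branch x y" for z
    using that assms(3)[OF n(1), of z] n by (auto simp: cell_Suc_eq_iff)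
  then show ?thesis by blast
qed

end

section \<open>Words, supports and parities in a free Boolean group\<close>

lemma boolean_fin_sets_group_discrete:
  "boolean_topological_group (fin_sets_group Y) (discrete_topology (Fpow Y))"
  by (rule boolean_fin_sets_groupI)
    (simp_all add: prod_topology_discrete_topology[symmetric] sym_diff_Fpow Pi_iff)

text \<open>The pullback along a constant map is the indiscrete topology. Every map into it is
  continuous, so the universal property yields a purely algebraic extension, used to obtain
  \<open>support\<close>.\<close>

lemma boolean_fin_sets_group_indiscrete:
  "boolean_topological_group (fin_sets_group Y)
     (pullback_topology (Fpow Y) (\<lambda>_. {}) (discrete_topology (Fpow {})))"
  by (rule boolean_fin_sets_group_pullback[OF boolean_fin_sets_group_discrete])
    (auto simp: hom_def Fpow_def)

locale free_boolean =
  fixes X :: "'x topology" and G :: "'g monoid" and T \<iota>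
  assumes free: "free_boolean_topological_group X G T \<iota>"
begin

sublocale comm_group G
  using free by (auto simp: free_boolean_topological_group_def boolean_topological_group_def
      topological_group_def group_with_topology_def intro: boolean_comm_group)

lemma topspace_T: "topspace T = carrier G"
  and self_mult: "\<forall>x\<in>carrier G. x \<otimes>\<^bsub>G\<^esub> x = \<one>\<^bsub>G\<^esub>"
  and continuous_mult: "continuous_map (prod_topology T T) T (\<lambda>(x, y). x \<otimes>\<^bsub>G\<^esub> y)"
  using free by (auto simp: free_boolean_topological_group_def boolean_topological_group_def
      topological_group_def group_with_topology_def)

lemma continuous_\<iota>: "continuous_map X T \<iota>"
proof -
  have "homeomorphic_map X (subtopology T (\<iota> ` topspace X)) \<iota>"
    using free by (simp add: free_boolean_topological_group_def embedding_map_def)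
  then show ?thesis
    by (rule continuous_map_into_fulltopology[OF homeomorphic_imp_continuous_map])
qed

lemma \<iota>_closed: "x \<in> topspace X \<Longrightarrow> \<iota> x \<in> carrier G"
  using continuous_\<iota> topspace_T by (auto simp: continuous_map_def)

definition word :: "'x list \<Rightarrow> 'g" where
  "word xs = foldr (\<lambda>x g. \<iota> x \<otimes>\<^bsub>G\<^esub> g) xs \<one>\<^bsub>G\<^esub>"

lemma word_simps [simp]: "word [] = \<one>\<^bsub>G\<^esub>" "word (x # xs) = \<iota> x \<otimes>\<^bsub>G\<^esub> word xs"
  by (simp_all add: word_def)

lemma word_closed: "xs \<in> lists (topspace X) \<Longrightarrow> word xs \<in> carrier G"
  by (induction xs) (auto simp: \<iota>_closed)

lemma word_append:
  "xs \<in> lists (topspace X) \<Longrightarrow> ys \<in> lists (topspace X) \<Longrightarrow> word (xs @ ys) = word xs \<otimes>\<^bsub>G\<^esub> word ys"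
  by (induction xs) (auto simp: \<iota>_closed word_closed m_assoc)

lemma carrier_eq_words: "carrier G = word ` lists (topspace X)"
proof
  show "word ` lists (topspace X) \<subseteq> carrier G" using word_closed by blast
  have "g \<in> word ` lists (topspace X)" if "g \<in> generate G (\<iota> ` topspace X)" for g
    using that
  proof induction
    case one
    then show ?case by (intro image_eqI[of _ _ "[]"]) simp_all
  next
    case (incl h)
    then obtain x where "x \<in> topspace X" "h = \<iota> x" by blast
    then show ?case by (intro image_eqI[of _ _ "[x]"]) (simp_all add: \<iota>_closed)
  next
    case (inv h)
    then obtain x where x: "x \<in> topspace X" "h = \<iota> x" by blast
    then have "inv\<^bsub>G\<^esub> h = h" using self_mult \<iota>_closed by (simp add: inv_equality)
    then show ?case using x by (intro image_eqI[of _ _ "[x]"]) (simp_all add: \<iota>_closed)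
  next
    case (eng g h)
    then obtain xs ys where "xs \<in> lists (topspace X)" "ys \<in> lists (topspace X)" "g = word xs" "h = word ys"
      by blast
    then show ?case by (intro image_eqI[of _ _ "xs @ ys"]) (simp_all add: word_append)
  qed
  then show "carrier G \<subseteq> word ` lists (topspace X)"
    using free by (auto simp: free_boolean_topological_group_def)
qed

lemma fin_sets_hom_exists:
  assumes "boolean_topological_group (fin_sets_group Y) S" "continuous_map X S (\<lambda>x. {p x})"
  obtains g where "g \<in> hom G (fin_sets_group Y)" "continuous_map T S g"
    "\<And>x. x \<in> topspace X \<Longrightarrow> g (\<iota> x) = {p x}"
  using free_boolean_topological_group_universal[OF free assms] by metis

lemma fin_sets_hom_one: "g \<in> hom G (fin_sets_group Y) \<Longrightarrow> g \<one>\<^bsub>G\<^esub> = {}"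
  using hom_one[OF _ is_group group_fin_sets_group] by simp

text \<open>The letters of the reduced word of an element. The group is abstract, so this is chosen
  as a homomorphism extending \<open>x\<close> to \<open>{x}\<close>; since letters generate
  \<open>G\<close>, its values on the carrier are determined.\<close>

definition support :: "'g \<Rightarrow> 'x set" where
  "support = (SOME \<sigma>. \<sigma> \<in> hom G (fin_sets_group (topspace X)) \<and> (\<forall>x\<in>topspace X. \<sigma> (\<iota> x) = {x}))"

lemma support_hom: "support \<in> hom G (fin_sets_group (topspace X))"
  and support_\<iota>: "x \<in> topspace X \<Longrightarrow> support (\<iota> x) = {x}"
proof -
  let ?S = "pullback_topology (Fpow (topspace X)) (\<lambda>_. {} :: 'x set) (discrete_topology (Fpow {}))"
  have "continuous_map X ?S (\<lambda>x. {x})"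
    by (rule continuous_map_pullback') (auto simp: o_def Fpow_def)
  from fin_sets_hom_exists[OF boolean_fin_sets_group_indiscrete this]
  have "\<exists>\<sigma>. \<sigma> \<in> hom G (fin_sets_group (topspace X)) \<and> (\<forall>x\<in>topspace X. \<sigma> (\<iota> x) = {x})"
    by metis
  from someI_ex[OF this] show "support \<in> hom G (fin_sets_group (topspace X))"
    and "x \<in> topspace X \<Longrightarrow> support (\<iota> x) = {x}" by (auto simp: support_def)
qed

lemma support_Fpow: "g \<in> carrier G \<Longrightarrow> finite (support g) \<and> support g \<subseteq> topspace X"
  using support_hom by (auto simp: hom_def Fpow_def)

lemma support_word_Cons:
  "x \<in> topspace X \<Longrightarrow> xs \<in> lists (topspace X) \<Longrightarrow>
    support (word (x # xs)) = sym_diff {x} (support (word xs))"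
  using hom_mult[OF support_hom, of "\<iota> x" "word xs"] by (simp add: \<iota>_closed word_closed support_\<iota>)

text \<open>Induction on a word for \<open>g\<close>: a repeated letter cancels both in the group
  and in the symmetric difference. It follows that \<open>support\<close> is injective on the
  carrier.\<close>

lemma finprod_support: "g \<in> carrier G \<Longrightarrow> finprod G \<iota> (support g) = g"
proof -
  have "finprod G \<iota> (support (word xs)) = word xs" if "xs \<in> lists (topspace X)" for xs
    using that
  proof (induction xs)
    case Nil
    then show ?case by (simp add: fin_sets_hom_one[OF support_hom])
  next
    case (Cons x xs)
    then have x: "x \<in> topspace X" and xs: "xs \<in> lists (topspace X)" by auto
    have "finprod G \<iota> (sym_diff {x} (support (word xs))) = finprod G \<iota> {x} \<otimes>\<^bsub>G\<^esub> finprod G \<iota> (support (word xs))"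
      by (rule boolean_finprod_sym_diff[OF comm_group_axioms self_mult])
        (use x xs support_Fpow[OF word_closed] \<iota>_closed in auto)
    moreover have "finprod G \<iota> {x} = \<iota> x" using x by (simp add: \<iota>_closed)
    ultimately show ?case
      using Cons.IH xs unfolding support_word_Cons[OF x xs] by simp
  qed
  then show "g \<in> carrier G \<Longrightarrow> finprod G \<iota> (support g) = g"
    unfolding carrier_eq_words by blast
qed

lemma inj_on_support: "inj_on support (carrier G)"
  using finprod_support by (metis inj_onI)

text \<open>The colouring \<open>p\<close> extends to a continuous homomorphism \<open>\<pi>\<close>
  into the discrete group of finite sets of colours, and \<open>\<pi> g\<close> consists of the
  colours occurring an odd number of times in the support. The fibre of \<open>\<pi>\<close> through
  \<open>g\<close> is open and serves all \<open>E\<close> at once.\<close>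

lemma support_parity_locally_constant:
  fixes p :: "'x \<Rightarrow> 'd"
  assumes p: "continuous_map X (discrete_topology UNIV) p" and g: "g \<in> carrier G"
  obtains N where "openin T N" "g \<in> N"
    "\<And>h E. h \<in> N \<Longrightarrow> odd (card {x \<in> support h. p x \<in> E}) = odd (card {x \<in> support g. p x \<in> E})"
proof -
  have "continuous_map (discrete_topology UNIV) (discrete_topology (Fpow UNIV)) (\<lambda>d :: 'd. {d})"
    by (simp add: Fpow_def)
  from continuous_map_compose[OF p this]
  have "continuous_map X (discrete_topology (Fpow UNIV)) (\<lambda>x. {p x})"
    by (simp add: o_def)
  from fin_sets_hom_exists[OF boolean_fin_sets_group_discrete this]
  obtain \<pi> where \<pi>: "\<pi> \<in> hom G (fin_sets_group (UNIV :: 'd set))"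
    and cont: "continuous_map T (discrete_topology (Fpow UNIV)) \<pi>"
    and \<pi>_\<iota>: "\<And>x. x \<in> topspace X \<Longrightarrow> \<pi> (\<iota> x) = {p x}" by metis
  have fin: "finite (\<pi> h)" if "h \<in> carrier G" for h
    using \<pi> that by (auto simp: hom_def Fpow_def)
  have "odd (card {x \<in> support (word xs). p x \<in> E}) = odd (card (\<pi> (word xs) \<inter> E))"
    if "xs \<in> lists (topspace X)" for xs E
    using that
  proof (induction xs)
    case Nil
    then show ?case by (simp add: fin_sets_hom_one[OF support_hom] fin_sets_hom_one[OF \<pi>])
  next
    case (Cons x xs)
    then have x: "x \<in> topspace X" and xs: "xs \<in> lists (topspace X)" by auto
    have "{y \<in> support (word (x # xs)). p y \<in> E}
        = sym_diff {y \<in> {x}. p y \<in> E} {y \<in> support (word xs). p y \<in> E}"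
      unfolding support_word_Cons[OF x xs] by auto
    then have 1: "odd (card {y \<in> support (word (x # xs)). p y \<in> E}) \<longleftrightarrow>
        odd (card {y \<in> {x}. p y \<in> E}) \<noteq> odd (card {y \<in> support (word xs). p y \<in> E})"
      using support_Fpow[OF word_closed[OF xs]] by (simp add: odd_card_sym_diff)
    have "{y \<in> {x}. p y \<in> E} = (if p x \<in> E then {x} else {})" by auto
    then have 2: "odd (card {y \<in> {x}. p y \<in> E}) \<longleftrightarrow> p x \<in> E" by simp
    have "\<pi> (word (x # xs)) \<inter> E = sym_diff ({p x} \<inter> E) (\<pi> (word xs) \<inter> E)"
      using hom_mult[OF \<pi>, of "\<iota> x" "word xs"] x xs by (auto simp: \<iota>_closed word_closed \<pi>_\<iota>)
    then have 3: "odd (card (\<pi> (word (x # xs)) \<inter> E)) \<longleftrightarrow> odd (card ({p x} \<inter> E)) \<noteq> odd (card (\<pi> (word xs) \<inter> E))"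
      using fin[OF word_closed[OF xs]] by (simp add: odd_card_sym_diff)
    have 4: "odd (card ({p x} \<inter> E)) \<longleftrightarrow> p x \<in> E" by (cases "p x \<in> E") simp_all
    show ?case by (simp only: 1 2 3 4 Cons.IH)
  qed
  then have par: "odd (card {x \<in> support h. p x \<in> E}) = odd (card (\<pi> h \<inter> E))" if "h \<in> carrier G" for h E
    using that unfolding carrier_eq_words by blast
  show thesis
  proof (rule that)
    have "\<pi> g \<in> Fpow UNIV" using fin[OF g] by (simp add: Fpow_def)
    then show "openin T {h \<in> topspace T. \<pi> h \<in> {\<pi> g}}"
      by (intro openin_continuous_map_preimage[OF cont]) simp
  qed (use g par topspace_T in auto)
qed

section \<open>Lindelof countable powers and separability of the free group\<close>

lemma continuous_map_word:
  fixes ks :: "nat list"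
  shows "continuous_map (countable_power X) T (\<lambda>x. word (map x ks))"
proof (induction ks)
  case Nil
  then show ?case by (simp add: topspace_T)
next
  case (Cons k ks)
  have "continuous_map (countable_power X) X (\<lambda>x. x k)"
    unfolding countable_power_def by (rule continuous_map_product_projection) simp
  from continuous_map_compose[OF this continuous_\<iota>]
  have "continuous_map (countable_power X) (prod_topology T T) (\<lambda>x. (\<iota> (x k), word (map x ks)))"
    using Cons by (simp add: continuous_map_paired o_def)
  from continuous_map_compose[OF this continuous_mult] show ?case by (simp add: o_def)
qed

text \<open>Reading off the word length \<open>q (x 0)\<close> makes \<open>G\<close> a continuous image of \<open>X\<^sup>\<omega>\<close> itself,
  so that no product with a discrete factor is needed.\<close>

lemma Lindelof_countable_power:
  assumes X: "Lindelof_space (countable_power X)"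
    and q: "continuous_map X (discrete_topology UNIV) q" "q ` topspace X = (UNIV :: nat set)"
  shows "Lindelof_space (countable_power T)"
proof -
  \<comment> \<open>Coordinate 0 supplies only the length; the letters are coordinates 1 up to that
    length.\<close>
  define s where "s x = word (map x [1..<Suc (q (x 0))])" for x
  have top: "topspace (countable_power X) = UNIV \<rightarrow>\<^sub>E topspace X"
    by (simp add: countable_power_def)
  have s: "continuous_map (countable_power X) T s"
    unfolding continuous_map_def
  proof (intro conjI allI impI)
    show "s \<in> topspace (countable_power X) \<rightarrow> topspace T"
      unfolding s_def topspace_T top by (intro funcsetI word_closed) (auto simp: PiE_iff)
    fix U assume U: "openin T U"
    have "openin (countable_power X) {x \<in> topspace (countable_power X). q (x 0) \<in> {n}}" for n
    proof (rule openin_continuous_map_preimage)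
      have "continuous_map (countable_power X) X (\<lambda>x. x 0)"
        unfolding countable_power_def by (rule continuous_map_product_projection) simp
      from continuous_map_compose[OF this q(1)]
      show "continuous_map (countable_power X) (discrete_topology UNIV) (\<lambda>x. q (x 0))"
        by (simp add: o_def)
    qed simp
    moreover have "openin (countable_power X) {x \<in> topspace (countable_power X). word (map x ks) \<in> U}" for ks :: "nat list"
      by (rule openin_continuous_map_preimage[OF continuous_map_word U])
    \<comment> \<open>The length is locally constant, and for a fixed length the word depends
      continuously on its letters.\<close>
    ultimately have "openin (countable_power X) (\<Union>n. {x \<in> topspace (countable_power X). q (x 0) \<in> {n}} \<inter>
        {x \<in> topspace (countable_power X). word (map x [1..<Suc n]) \<in> U})"
      by (intro openin_Union) (auto intro!: openin_Int)
    moreover have "(\<Union>n. {x \<in> topspace (countable_power X). q (x 0) \<in> {n}} \<inter>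
        {x \<in> topspace (countable_power X). word (map x [1..<Suc n]) \<in> U})
        = {x \<in> topspace (countable_power X). s x \<in> U}"
      unfolding s_def by blast
    ultimately show "openin (countable_power X) {x \<in> topspace (countable_power X). s x \<in> U}" by simp
  qed
  have surj: "\<exists>x\<in>UNIV \<rightarrow> topspace X. s x = g" if g: "g \<in> carrier G" for g
  proof -
    obtain xs where xs: "xs \<in> lists (topspace X)" "g = word xs"
      using g carrier_eq_words by auto
    obtain z where z: "z \<in> topspace X" "q z = length xs" using q(2) by (metis UNIV_I image_iff)
    \<comment> \<open>The letters are shifted by one to free coordinate 0 for \<open>z\<close>,
      whose value under \<open>q\<close> is the length; \<open>z\<close> also fills the coordinates
      after the word.\<close>
    define x where "x k = (if k = 0 \<or> length xs < k then z else xs ! (k - 1))" for k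
    have "map x [1..<Suc (length xs)] = xs"
      by (rule nth_equalityI) (auto simp: x_def nth_append simp del: upt_Suc)
    then have "s x = g" using z xs by (simp add: s_def x_def del: upt_Suc)
    moreover have "x k \<in> topspace X" for k
      using xs(1) z(1) by (auto simp: x_def in_lists_conv_set)
    ultimately show ?thesis by blast
  qed
  \<comment> \<open>\<open>prod_encode\<close> arranges the coordinates in infinitely many rows, and
    row \<open>m\<close> produces the group element at coordinate \<open>m\<close>.\<close>
  define t where "t x m = s (\<lambda>n. x (prod_encode (m, n)))" for x m
  have "continuous_map (countable_power X) (countable_power T) t"
    unfolding countable_power_def[of T] continuous_map_componentwise_UNIV
  proof
    fix m
    have "continuous_map (countable_power X) (countable_power X) (\<lambda>x n. x (prod_encode (m, n)))"
      unfolding countable_power_def continuous_map_componentwise_UNIV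
      by (auto intro: continuous_map_product_projection)
    from continuous_map_compose[OF this s]
    show "continuous_map (countable_power X) T (\<lambda>x. t x m)" by (simp add: o_def t_def)
  qed
  moreover have "t ` topspace (countable_power X) = topspace (countable_power T)"
  proof
    show "t ` topspace (countable_power X) \<subseteq> topspace (countable_power T)"
      using calculation by (rule continuous_map_image_subset_topspace)
    show "topspace (countable_power T) \<subseteq> t ` topspace (countable_power X)"
    proof
      fix y assume "y \<in> topspace (countable_power T)"
      then have "y m \<in> carrier G" for m by (auto simp: countable_power_def topspace_T)
      then have "\<forall>m. \<exists>x. x \<in> UNIV \<rightarrow> topspace X \<and> s x = y m" using surj by blast
      then obtain x where x: "\<And>m. x m \<in> UNIV \<rightarrow> topspace X" "\<And>m. s (x m) = y m" by metis
      define z where "z k = x (fst (prod_decode k)) (snd (prod_decode k))" for k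
      have "t z = y" using x(2) by (auto simp: t_def z_def)
      moreover have "z k \<in> topspace X" for k
        using x(1)[of "fst (prod_decode k)"] by (auto simp: z_def)
      then have "z \<in> topspace (countable_power X)" by (simp add: top PiE_iff)
      ultimately show "y \<in> t ` topspace (countable_power X)" by blast
    qed
  qed
  ultimately show ?thesis using X by (blast intro: Lindelof_space_continuous_map_image)
qed

text \<open>Words over a countable dense subset of \<open>X\<close> are dense: by continuity of
  multiplication the letters of a word can be replaced one by one without leaving a given open
  set.\<close>

lemma separable_space_free:
  assumes "separable_space X" shows "separable_space T"
proof -
  obtain D where D: "countable D" "D \<subseteq> topspace X" "X closure_of D = topspace X"
    using assms by (auto simp: separable_space_def)
  have "\<exists>ys\<in>lists D. word ys \<in> U" if "xs \<in> lists (topspace X)" "openin T U" "word xs \<in> U" for xs U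
    using that
  proof (induction xs arbitrary: U)
    case Nil
    then show ?case by (intro bexI[of _ "[]"]) auto
  next
    case (Cons x xs)
    then have x: "x \<in> topspace X" and xs: "xs \<in> lists (topspace X)" by simp_all
    let ?m = "\<lambda>(x, y). x \<otimes>\<^bsub>G\<^esub> y"
    define S where "S = {z \<in> topspace (prod_topology T T). ?m z \<in> U}"
    have S: "openin (prod_topology T T) S"
      unfolding S_def by (rule openin_continuous_map_preimage[OF continuous_mult Cons.prems(1)])
    have "(\<iota> x, word xs) \<in> S"
      using Cons.prems x xs by (simp add: S_def topspace_T \<iota>_closed word_closed)
    from openin_prod_topology_alt[THEN iffD1, rule_format, OF S this]
    obtain V W where VW: "openin T V" "openin T W" "\<iota> x \<in> V" "word xs \<in> W" "V \<times> W \<subseteq> S"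
      by (elim exE conjE)
    define V' where "V' = {z \<in> topspace X. \<iota> z \<in> V}"
    have V': "openin X V'" "x \<in> V'"
      unfolding V'_def using x VW(3) openin_continuous_map_preimage[OF continuous_\<iota> VW(1)] by simp_all
    have "x \<in> X closure_of D" using x D(3) by simp
    then have "\<exists>d. d \<in> D \<and> d \<in> V'"
      using V' by (simp add: in_closure_of)
    then obtain d where "d \<in> D" "\<iota> d \<in> V" by (auto simp: V'_def)
    moreover obtain ys where "ys \<in> lists D" "word ys \<in> W"
      using Cons.IH[OF VW(2,4)] by blast
    ultimately show ?case using VW(5) by (intro bexI[of _ "d # ys"]) (auto simp: S_def)
  qed
  then have "topspace T \<subseteq> T closure_of (word ` lists D)"
    unfolding topspace_T carrier_eq_words in_closure_of subset_iff
    by (auto simp: in_closure_of topspace_T word_closed)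
  moreover have "countable (word ` lists D)" using D(1) by simp
  moreover have "word ` lists D \<subseteq> topspace T"
    using D(2) word_closed by (auto simp: topspace_T)
  ultimately show ?thesis
    unfolding separable_space_def by (metis closure_of_subset_topspace subset_antisym)
qed

end

section \<open>Refinements of the Euclidean topology\<close>

text \<open>One form for the three topologies, with \<open>W x\<close> a singleton, a closed lower
  half-line or a closed upper half-line.\<close>

definition refined_topology :: "real set \<Rightarrow> real set \<Rightarrow> (real \<Rightarrow> real set) \<Rightarrow> real topology" where
  "refined_topology X A W = topology_generated_by
     ({U. openin (top_of_set X) U} \<union> {X \<inter> W x |x. x \<in> X - A})"

text \<open>Openness of \<open>W x - {x}\<close> means that adding \<open>W x\<close> to the subbase
  creates new neighbourhoods at \<open>x\<close> only. The other clause says that a cut between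
  \<open>x\<close> and a point outside \<open>W x\<close> leaves all of \<open>W x\<close> on one
  side; it is what \<open>off_branch_disjoint\<close> asks for.\<close>

definition nbhd_shape :: "(real \<Rightarrow> real set) \<Rightarrow> bool" where
  "nbhd_shape W \<longleftrightarrow> (\<forall>x. x \<in> W x \<and> open (W x - {x}) \<and>
     (\<forall>t. \<forall>y. \<forall>z\<in>W x. y \<notin> W x \<and> (t < x) \<noteq> (t < y) \<longrightarrow> t < z \<longleftrightarrow> t < x))"

lemma nbhd_shapes: "nbhd_shape (\<lambda>x. {x})" "nbhd_shape (\<lambda>x. {..x})" "nbhd_shape (\<lambda>x. {x..})"
proof -
  have "{..x} - {x} = {..<x}" "{x..} - {x} = {x<..}" for x :: real by auto
  then show "nbhd_shape (\<lambda>x. {x})" "nbhd_shape (\<lambda>x. {..x})" "nbhd_shape (\<lambda>x. {x..})"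
    unfolding nbhd_shape_def by auto
qed

lemma isolating_topology_eq: "isolating_topology X A = refined_topology X A (\<lambda>x. {x})"
proof -
  have "{{x} |x. x \<in> X - A} = {X \<inter> {x} |x. x \<in> X - A}" by blast
  then show ?thesis by (simp add: isolating_topology_def refined_topology_def)
qed

lemma right_closed_topology_eq: "right_closed_topology X A = refined_topology X A (\<lambda>x. {..x})"
  and left_closed_topology_eq: "left_closed_topology X A = refined_topology X A (\<lambda>x. {x..})"
  by (simp_all add: right_closed_topology_def left_closed_topology_def refined_topology_def)

lemma topspace_refined [simp]: "topspace (refined_topology X A W) = X"
proof -
  have "openin (top_of_set X) X" by simp
  moreover have "U \<subseteq> X" if "openin (top_of_set X) U" for U using openin_subset[OF that] by simp
  ultimately show ?thesis unfolding refined_topology_def topology_generated_by_topspace by blast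
qed

lemma openin_refined_euclidean: "open U \<Longrightarrow> openin (refined_topology X A W) (X \<inter> U)"
  unfolding refined_topology_def by (rule topology_generated_by_Basis) auto

lemma openin_refined_shape: "x \<in> X - A \<Longrightarrow> openin (refined_topology X A W) (X \<inter> W x)"
  unfolding refined_topology_def by (rule topology_generated_by_Basis) blast

text \<open>Induction on the generation of \<open>U\<close>. A subbasic set \<open>W c\<close> with
  \<open>c\<close> different from \<open>x\<close> is a Euclidean neighbourhood of \<open>x\<close>,
  so only \<open>W x\<close> itself can restrict the ball.\<close>

lemma refined_nbhd:
  assumes W: "nbhd_shape W" and U: "openin (refined_topology X A W) U" and x: "x \<in> U"
  shows "\<exists>e>0. X \<inter> ball x e \<inter> (if x \<in> A then UNIV else W x) \<subseteq> U"
proof -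
  have "generate_topology_on ({U. openin (top_of_set X) U} \<union> {X \<inter> W x |x. x \<in> X - A}) U"
    using U unfolding refined_topology_def by (rule openin_topology_generated_by)
  then show ?thesis using x
  proof (induction arbitrary: x)
    case Empty
    then show ?case by simp
  next
    case (Int a b)
    let ?W = "if x \<in> A then UNIV else W x"
    have "x \<in> a" "x \<in> b" using Int.prems by simp_all
    from Int.IH(1)[OF this(1)] obtain d where d: "d > 0" "X \<inter> ball x d \<inter> ?W \<subseteq> a"
      by (elim exE conjE)
    from Int.IH(2)[OF \<open>x \<in> b\<close>] obtain e where e: "e > 0" "X \<inter> ball x e \<inter> ?W \<subseteq> b"
      by (elim exE conjE)
    have "X \<inter> ball x (min d e) \<inter> ?W \<subseteq> a" "X \<inter> ball x (min d e) \<inter> ?W \<subseteq> b"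
      by (rule order.trans[OF _ d(2)], force) (rule order.trans[OF _ e(2)], force)
    then show ?case using d(1) e(1) by (intro exI[of _ "min d e"]) simp
  next
    case (UN K)
    then obtain k where k: "k \<in> K" "x \<in> k" by blast
    from UN.IH[OF this] obtain e where "e > 0" "X \<inter> ball x e \<inter> (if x \<in> A then UNIV else W x) \<subseteq> k"
      by blast
    then show ?case using k(1) by (intro exI[of _ e]) blast
  next
    case (Basis s)
    then consider "openin (top_of_set X) s" | c where "c \<in> X - A" "s = X \<inter> W c" by blast
    then show ?case
    proof cases
      case 1
      then obtain V where V: "open V" "s = X \<inter> V" by (auto simp: openin_open)
      then obtain e where "e > 0" "ball x e \<subseteq> V" using Basis.prems open_contains_ball by blast
      then show ?thesis using V(2) by (intro exI[of _ e]) blast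
    next
      case 2
      show ?thesis
      proof (cases "x = c")
        case True
        then show ?thesis using 2 by (intro exI[of _ 1]) auto
      next
        case False
        then have "x \<in> W c - {c}" using 2 Basis.prems by simp
        moreover have "open (W c - {c})" using W by (simp add: nbhd_shape_def)
        ultimately obtain e where "e > 0" "ball x e \<subseteq> W c - {c}" using open_contains_ball by blast
        then show ?thesis using 2(2) by (intro exI[of _ e]) blast
      qed
    qed
  qed
qed

section \<open>Density of the partition sets, dense sequences, Lindelof powers of subspaces\<close>

lemma Lindelof_isolating_imp_dense:
  assumes lin: "Lindelof_space (countable_power (isolating_topology UNIV M))" and ab: "a < b"
  shows "\<exists>x\<in>M. a < x \<and> x < b"
proof (rule ccontr)
  let ?Z = "refined_topology UNIV M (\<lambda>x. {x})"
  assume "\<not> ?thesis"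
  then have disj: "M \<inter> {a<..<b} = {}" by auto
  \<comment> \<open>The open interval misses \<open>M\<close> but need not be closed, so a closed
    subinterval is taken.\<close>
  obtain a' b' where ab': "a < a'" "a' < b'" "b' < b" using ab dense by meson
  have "continuous_map (countable_power ?Z) ?Z (\<lambda>x. x 0)"
    unfolding countable_power_def by (rule continuous_map_product_projection) simp
  moreover have "(\<lambda>x. x 0) ` topspace (countable_power ?Z) = topspace ?Z"
    by (auto simp: countable_power_def intro!: image_eqI[of _ _ "\<lambda>_. _"])
  ultimately have "Lindelof_space ?Z"
    using lin Lindelof_space_continuous_map_image unfolding isolating_topology_eq by blast
  moreover have "closedin ?Z {a'..b'}"
    using openin_refined_euclidean[OF open_Compl[OF closed_atLeastAtMost], of UNIV M "\<lambda>x. {x}" a' b']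
    by (simp add: closedin_def Compl_eq_Diff_UNIV)
  ultimately have "Lindelof_space (subtopology ?Z {a'..b'})"
    by (rule Lindelof_space_closedin_subtopology)
  moreover have "subtopology ?Z {a'..b'} = discrete_topology {a'..b'}"
  proof (subst eq_commute, subst discrete_topology_unique, intro conjI ballI)
    fix x assume x: "x \<in> {a'..b'}"
    then have "x \<in> UNIV - M" using disj ab' by auto
    from openin_refined_shape[OF this, of "\<lambda>x. {x}"] have "openin ?Z {x}" by simp
    then show "openin (subtopology ?Z {a'..b'}) {x}"
      using x unfolding openin_subtopology by (intro exI[of _ "{x}"]) auto
  qed simp
  ultimately have "Lindelof_space (discrete_topology {a'..b'})" by simp
  from Lindelof_spaceD[OF this, of "(\<lambda>x. {x}) ` {a'..b'}"]
  obtain \<V> where \<V>: "countable \<V>" "\<V> \<subseteq> (\<lambda>x. {x}) ` {a'..b'}" "\<Union>\<V> = {a'..b'}" by auto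
  have "countable (\<Union>V\<in>\<V>. V)" using \<V>(1,2) by (intro countable_UN) auto
  then have "countable {a'..b'}" by (simp add: \<V>(3))
  then show False using uncountable_closed_interval ab' by blast
qed

text \<open>One point of \<open>S\<close> is chosen in each interval with rational endpoints, and
  these countably many intervals are enumerated.\<close>

lemma dense_sequence:
  fixes S :: "real set"
  assumes "\<And>u v. u < v \<Longrightarrow> \<exists>s\<in>S. u < s \<and> s < v"
  obtains b :: "nat \<Rightarrow> real" where "range b \<subseteq> S" "\<And>u v. u < v \<Longrightarrow> \<exists>n. u < b n \<and> b n < v"
proof -
  obtain s where s: "\<And>u v. u < v \<Longrightarrow> s u v \<in> S \<and> u < s u v \<and> s u v < v"
    using assms by metis
  define P where "P = {(p, q). p \<in> \<rat> \<and> q \<in> \<rat> \<and> p < (q :: real)}"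
  have "P \<subseteq> \<rat> \<times> \<rat>" by (auto simp: P_def)
  then have cP: "countable P" using countable_rat countable_SIGMA countable_subset by metis
  have "(0, 1) \<in> P" by (simp add: P_def)
  then have P0: "P \<noteq> {}" by blast
  define b where "b n = (case from_nat_into P n of (p, q) \<Rightarrow> s p q)" for n
  show thesis
  proof
    show "range b \<subseteq> S"
    proof
      fix x assume "x \<in> range b"
      then obtain n where n: "x = b n" by blast
      obtain p q where pq: "from_nat_into P n = (p, q)" by fastforce
      then have "p < q" using from_nat_into[OF P0, of n] by (simp add: P_def)
      then show "x \<in> S" using s n pq by (simp add: b_def)
    qed
    fix u v :: real assume "u < v"
    then obtain p q where pq: "u < p" "p < q" "q < v" "p \<in> \<rat>" "q \<in> \<rat>"
      by (meson Rats_dense_in_real)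
    then obtain n where "from_nat_into P n = (p, q)"
      using from_nat_into_surj[OF cP, of "(p, q)"] by (auto simp: P_def)
    then show "\<exists>n. u < b n \<and> b n < v"
      using s[OF pq(2)] pq by (intro exI[of _ n]) (auto simp: b_def)
  qed
qed

text \<open>In \<open>isolating_topology UNIV A\<close> the complement of \<open>L\<close> consists
  of isolated points, so \<open>L\<close> is closed, and so is its power in the Lindelof power. The
  refined topology for any \<open>W\<close> is coarser than the isolating one on \<open>L\<close>,
  so the identity carries the property over.\<close>

lemma Lindelof_countable_power_refined:
  assumes lin: "Lindelof_space (countable_power (isolating_topology UNIV A))"
    and A: "A \<subseteq> L" and W: "nbhd_shape W"
  shows "Lindelof_space (countable_power (refined_topology L A W))"
proof -
  let ?Z = "refined_topology UNIV A (\<lambda>x. {x})" and ?X = "refined_topology L A W"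
  let ?P = "UNIV \<rightarrow>\<^sub>E L"
  have iso: "openin ?Z {x}" if "x \<notin> A" for x
    using openin_refined_shape[of x UNIV A "\<lambda>x. {x}"] that by simp
  have "openin ?Z (- L)"
    by (subst openin_subopen) (use iso A in blast)
  then have "closedin ?Z L" by (simp add: closedin_def Compl_eq_Diff_UNIV)
  then have "closedin (countable_power ?Z) ?P"
    by (simp add: countable_power_def closedin_product_topology)
  then have "Lindelof_space (subtopology (countable_power ?Z) ?P)"
    using lin by (intro Lindelof_space_closedin_subtopology) (simp_all add: isolating_topology_eq)
  moreover have id: "continuous_map (subtopology ?Z L) ?X (\<lambda>x. x)"
    unfolding continuous_map_def
  proof (intro conjI allI impI)
    fix U assume U: "openin ?X U"
    have UL: "U \<subseteq> L" using openin_subset[OF U] by simp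
    have "\<exists>V. openin (subtopology ?Z L) V \<and> x \<in> V \<and> V \<subseteq> U" if x: "x \<in> U" for x
    proof (cases "x \<in> A")
      case True
      then obtain e where "e > 0" "L \<inter> ball x e \<subseteq> U" using refined_nbhd[OF W U x] by auto
      moreover have "openin (subtopology ?Z L) (L \<inter> ball x e)"
        using openin_refined_euclidean[of "ball x e" UNIV A "\<lambda>x. {x}"]
        by (auto simp: openin_subtopology)
      ultimately show ?thesis using x UL by (intro exI[of _ "L \<inter> ball x e"]) auto
    next
      case False
      then have "openin (subtopology ?Z L) {x}"
        using iso UL x unfolding openin_subtopology by (intro exI[of _ "{x}"]) auto
      then show ?thesis using x by blast
    qed
    then have "openin (subtopology ?Z L) U" by (subst openin_subopen) blast
    moreover have "{x \<in> topspace (subtopology ?Z L). x \<in> U} = U" using UL by auto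
    ultimately show "openin (subtopology ?Z L) {x \<in> topspace (subtopology ?Z L). x \<in> U}" by simp
  qed simp
  have "continuous_map (subtopology (countable_power ?Z) ?P) (countable_power ?X) (\<lambda>x. x)"
    unfolding countable_power_def[of ?X] continuous_map_componentwise_UNIV
  proof
    fix k
    have "continuous_map (countable_power ?Z) ?Z (\<lambda>x. x k)"
      unfolding countable_power_def by (rule continuous_map_product_projection) simp
    then have "continuous_map (subtopology (countable_power ?Z) ?P) (subtopology ?Z L) (\<lambda>x. x k)"
      by (auto simp: continuous_map_in_subtopology continuous_map_from_subtopology)
    from continuous_map_compose[OF this id]
    show "continuous_map (subtopology (countable_power ?Z) ?P) ?X (\<lambda>x. x k)" by (simp add: o_def)
  qed
  moreover have "(\<lambda>x. x) ` topspace (subtopology (countable_power ?Z) ?P) = topspace (countable_power ?X)"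
    by (simp add: countable_power_def)
  ultimately show ?thesis by (rule Lindelof_space_continuous_map_image)
qed

text \<open>The points \<open>c n\<close> lie outside \<open>L\<close> and increase to infinity, so
  they cut \<open>L\<close> into a sequence of open pieces, nonempty because \<open>L\<close> is
  dense; the map sends a point to the index of its piece.\<close>

lemma refined_onto_nat:
  assumes c: "\<And>n. real n < c n \<and> c n < real n + 1" "\<And>n. c n \<notin> L"
    and L: "\<And>u v. u < v \<Longrightarrow> \<exists>x\<in>L. u < x \<and> x < v"
  obtains q where "continuous_map (refined_topology L A W) (discrete_topology UNIV) q" "q ` L = (UNIV :: nat set)"
proof
  let ?q = "\<lambda>x. LEAST n. x < c n"
  have ex: "\<exists>n. x < c n" for x
  proof -
    obtain n where "x < real n" using reals_Archimedean2 by blast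
    then show ?thesis using c(1)[of n] by (intro exI[of _ n]) linarith
  qed
  have c_less: "c m < c n" if "m < n" for m n
  proof -
    have "real m + 1 \<le> real n" using that by simp
    then show ?thesis using c(1)[of m] c(1)[of n] by linarith
  qed
  \<comment> \<open>The lower end of piece \<open>n\<close>, as a set because piece 0 is unbounded
    below.\<close>
  define lo where "lo n = (if n = 0 then {} else {c (n - 1)})" for n
  have q_eq: "?q x = n \<longleftrightarrow> x < c n \<and> (\<forall>y\<in>lo n. y < x)" if "x \<in> L" for x n
  proof
    assume n: "?q x = n"
    have "x < c n" using LeastI_ex[OF ex] n by metis
    moreover have "y < x" if "y \<in> lo n" for y
    proof -
      have "n \<noteq> 0" "y = c (n - 1)" using that by (auto simp: lo_def split: if_splits)
      moreover from this have "\<not> x < y" using n not_less_Least[of "n - 1" "\<lambda>n. x < c n"] by simp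
      moreover have "x \<noteq> y" using c(2) \<open>x \<in> L\<close> calculation(2) by auto
      ultimately show ?thesis by simp
    qed
    ultimately show "x < c n \<and> (\<forall>y\<in>lo n. y < x)" by blast
  next
    assume *: "x < c n \<and> (\<forall>y\<in>lo n. y < x)"
    show "?q x = n"
    proof (rule Least_equality)
      show "n \<le> m" if "x < c m" for m
      proof (rule ccontr)
        assume "\<not> n \<le> m"
        then have "n \<noteq> 0" "m \<le> n - 1" by auto
        then have "c m \<le> c (n - 1)" using c_less[of m "n - 1"] by (cases "m = n - 1") auto
        then show False using * \<open>n \<noteq> 0\<close> that by (simp add: lo_def)
      qed
    qed (use * in simp)
  qed
  have opn: "open ({..<c n} \<inter> (\<Inter>y\<in>lo n. {y<..}))" for n
    by (auto simp: lo_def)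
  have fibre: "{x \<in> L. ?q x \<in> V} = (\<Union>n\<in>V. L \<inter> ({..<c n} \<inter> (\<Inter>y\<in>lo n. {y<..})))" for V
  proof -
    have "{x \<in> L. ?q x = n} = L \<inter> ({..<c n} \<inter> (\<Inter>y\<in>lo n. {y<..}))" for n
      using q_eq by auto
    moreover have "{x \<in> L. ?q x \<in> V} = (\<Union>n\<in>V. {x \<in> L. ?q x = n})" by blast
    ultimately show ?thesis by simp
  qed
  show "continuous_map (refined_topology L A W) (discrete_topology UNIV) ?q"
    unfolding continuous_map_def topspace_refined fibre
    using openin_refined_euclidean[OF opn] by (intro conjI allI impI openin_Union) auto
  show "?q ` L = UNIV"
  proof -
    have "n \<in> ?q ` L" for n
    proof -
      have "\<exists>u<c n. \<forall>y\<in>lo n. y \<le> u"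
        by (cases n) (use c_less[of "n - 1" n] in \<open>auto simp: lo_def intro: lt_ex\<close>)
      then obtain u x where "u < c n" "\<forall>y\<in>lo n. y \<le> u" "x \<in> L" "u < x" "x < c n"
        using L by blast
      then show ?thesis using q_eq[of x n] by (intro image_eqI[of _ _ x]) force+
    qed
    then show ?thesis by auto
  qed
qed

text \<open>By \<open>side\<close> every basic neighbourhood contains the trace of a Euclidean
  interval, so a countable Euclidean-dense subset of \<open>L\<close> is still dense. Half-lines
  satisfy \<open>side\<close>, singletons do not.\<close>

lemma separable_refined:
  assumes W: "nbhd_shape W" and L: "\<And>u v. u < v \<Longrightarrow> \<exists>x\<in>L. u < x \<and> x < v"
    and side: "\<And>x e. e > 0 \<Longrightarrow> \<exists>u v. u < v \<and> {u<..<v} \<subseteq> ball x e \<inter> W x"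
  shows "separable_space (refined_topology L A W)"
proof -
  obtain d where d: "range d \<subseteq> L" "\<And>u v. u < v \<Longrightarrow> \<exists>n::nat. u < d n \<and> d n < v"
    using dense_sequence[of L] L by metis
  have "\<exists>y\<in>range d. y \<in> U" if U: "openin (refined_topology L A W) U" and x: "x \<in> U" for U x
  proof -
    obtain e where e: "e > 0" "L \<inter> ball x e \<inter> (if x \<in> A then UNIV else W x) \<subseteq> U"
      using refined_nbhd[OF W U x] by blast
    obtain u v where uv: "u < v" "{u<..<v} \<subseteq> ball x e \<inter> W x" using side[OF e(1)] by blast
    obtain n where "u < d n" "d n < v" using d(2)[OF uv(1)] by blast
    then have "d n \<in> L \<inter> ball x e \<inter> W x" using uv(2) d(1) by auto
    then show ?thesis using e(2) by (cases "x \<in> A") auto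
  qed
  then have "L \<subseteq> refined_topology L A W closure_of range d"
    by (auto simp: in_closure_of)
  then show ?thesis
    unfolding separable_space_def using d(1)
    by (intro exI[of _ "range d"]) (use closure_of_subset_topspace[of "refined_topology L A W"] in auto)
qed

section \<open>Cells as small open sets of the refined topologies\<close>

context cuts begin

lemma open_cell: "x \<in> L \<Longrightarrow> openin (top_of_set L) {y \<in> L. cell n y = cell n x}"
proof (induction n)
  case 0
  then show ?case by (simp add: cell_def)
next
  case (Suc n)
  \<comment> \<open>The cut itself is not in \<open>L\<close>, so both of its sides are open in
    \<open>L\<close>.\<close>
  have "b n \<noteq> y" if "y \<in> L" for y using that b_notin by auto
  then have "{y \<in> L. (b n < y) = (b n < x)} = L \<inter> (if b n < x then {b n<..} else {..<b n})"
    by (auto simp: not_less order.order_iff_strict)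
  then have "openin (top_of_set L) {y \<in> L. (b n < y) = (b n < x)}" by (simp add: openin_open_Int)
  from openin_Int[OF Suc.IH[OF Suc.prems] this]
  show ?case
    by (rule back_subst[of "openin _"]) (auto simp: cell_Suc_eq_iff)
qed

lemma openin_refined_cell:
  assumes "x \<in> L" shows "openin (refined_topology L A W) {y \<in> L. cell n y = cell n x}"
  using open_cell[OF assms] unfolding refined_topology_def
  by (intro topology_generated_by_Basis) blast

lemma cell_subset_ball:
  assumes "e > 0" obtains n where "\<And>y. y \<in> L \<Longrightarrow> cell n y = cell n x \<Longrightarrow> y \<in> ball x e"
proof -
  obtain i j where ij: "x - e < b i" "b i < x" "x < b j" "b j < x + e"
    using b_between[of "x - e" x] b_between[of x "x + e"] assms by auto
  show thesis
  proof
    fix y assume y: "y \<in> L" "cell (Suc (max i j)) y = cell (Suc (max i j)) x"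
    \<comment> \<open>Level \<open>Suc (max i j)\<close> is the first to see both cuts, as level
      \<open>n\<close> uses only indices below \<open>n\<close>.\<close>
    then have "b i < y" "\<not> b j < y" using ij by (auto simp: cell_eq_iff)
    then show "y \<in> ball x e" using ij by (auto simp: dist_real_def abs_if)
  qed
qed

end

section \<open>The retraction onto the space of generators\<close>

text \<open>The colour of a point records its cell of level \<open>n\<close> and, outside the basic
  neighbourhood \<open>V\<close> of \<open>x\<close>, the off-branch containing it. Continuity holds
  because off-branches of points outside \<open>V\<close> are open and miss \<open>V\<close>; in
  particular \<open>V\<close> is clopen.\<close>

lemma (in cuts) refined_partition:
  fixes A :: "real set" and n :: nat
  assumes W: "nbhd_shape W" and x: "x \<in> L"
  defines "V \<equiv> L \<inter> (if x \<in> A then UNIV else W x)"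
  defines "p \<equiv> \<lambda>y. (cell n y, if y \<in> V then None else Some (off_branch x y))"
  shows "openin (refined_topology L A W) V" "x \<in> V"
    "continuous_map (refined_topology L A W) (discrete_topology UNIV) p"
    "y \<in> L - V \<Longrightarrow> {z \<in> L. snd (p z) = Some (off_branch x y)} = off_branch x y"
proof -
  let ?X = "refined_topology L A W"
  show opV: "openin ?X V"
    using x openin_topspace[of ?X] openin_refined_shape[of x L A W] by (auto simp: V_def)
  show xV: "x \<in> V" using W x by (simp add: V_def nbhd_shape_def)
  have disj: "off_branch x y \<inter> V = {}" if "y \<in> L - V" for y
  proof -
    have notA: "x \<notin> A" "y \<notin> W x" using that by (auto simp: V_def split: if_splits)
    have "off_branch x y \<inter> W x = {}"
    proof (rule off_branch_disjoint[OF notA(2)])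
      show "x \<in> W x" using W by (simp add: nbhd_shape_def)
      show "b i < z \<longleftrightarrow> b i < x" if "(b i < x) \<noteq> (b i < y)" "z \<in> W x" for i z
        using W that notA(2) unfolding nbhd_shape_def by blast
    qed
    moreover have "V \<subseteq> W x" using notA(1) by (simp add: V_def)
    ultimately show ?thesis by blast
  qed
  have off: "off_branch x z = off_branch x y" if "y \<in> L - V" "z \<in> off_branch x y" for y z
  proof (rule off_branch_cong(2)[OF _ that(2)])
    show "x \<noteq> y" using that(1) xV by auto
  qed
  show "{z \<in> L. snd (p z) = Some (off_branch x y)} = off_branch x y" if y: "y \<in> L - V"
  proof -
    have "off_branch x y \<subseteq> L" by (auto simp: off_branch_def Let_def)
    then show ?thesis
      using disj[OF y] off[OF y] in_off_branch_self by (auto simp: p_def)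
  qed
  show "continuous_map ?X (discrete_topology UNIV) p"
    unfolding continuous_map_def
  proof (intro conjI allI impI)
    fix E :: "(nat set \<times> real set option) set"
    have "\<exists>N. openin ?X N \<and> y \<in> N \<and> N \<subseteq> {y \<in> L. p y \<in> E}" if y: "y \<in> L" "p y \<in> E" for y
    proof (cases "y \<in> V")
      case True
      have "p z \<in> E" if "z \<in> V \<inter> {z \<in> L. cell n z = cell n y}" for z
        using that y True by (simp add: p_def)
      then show ?thesis
        using y True opV openin_refined_cell[OF y(1), of A W n]
        by (intro exI[of _ "V \<inter> {z \<in> L. cell n z = cell n y}"]) (auto intro!: openin_Int)
    next
      case False
      have "openin ?X (off_branch x y)"
        using openin_refined_cell[OF y(1)] by (simp add: off_branch_def Let_def)
      moreover have "p z \<in> E" if "z \<in> off_branch x y \<inter> {z \<in> L. cell n z = cell n y}" for z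
      proof -
        have "z \<notin> V" using disj[of y] that y False by auto
        then have "p z = p y" using that off[of y z] y False by (simp add: p_def)
        then show ?thesis using y by simp
      qed
      ultimately show ?thesis
        using y in_off_branch_self[OF y(1), of x] openin_refined_cell[OF y(1), of A W n]
        by (intro exI[of _ "off_branch x y \<inter> {z \<in> L. cell n z = cell n y}"]) (auto intro!: openin_Int)
    qed
    then have "openin ?X {y \<in> L. p y \<in> E}" by (subst openin_subopen) blast
    then show "openin ?X {y \<in> topspace ?X. p y \<in> E}" by simp
  qed simp
qed

locale free_boolean_refined =
  cuts L b + free_boolean "refined_topology L A W" G T \<iota>
  for L b A W and G :: "'g monoid" and T \<iota> +
  assumes shape: "nbhd_shape W"
begin

text \<open>Both families of parities count letters with colours in a fixed set, for the colouring
  of \<open>refined_partition\<close>: a cell of level \<open>k\<close> up to \<open>n\<close> is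
  read off from the first component, an off-branch from the second. So one neighbourhood serves
  both.\<close>

lemma odd_support_locally_constant:
  assumes g: "g \<in> carrier G" and x: "x \<in> L"
  obtains N where "openin T N" "g \<in> N"
    "\<And>h k z. h \<in> N \<Longrightarrow> k \<le> n \<Longrightarrow>
      odd (card {y \<in> support h. cell k y = cell k z}) = odd (card {y \<in> support g. cell k y = cell k z})"
    "\<And>h y. h \<in> N \<Longrightarrow> y \<in> L \<Longrightarrow> y \<notin> (if x \<in> A then UNIV else W x) \<Longrightarrow>
      odd (card (support h \<inter> off_branch x y)) = odd (card (support g \<inter> off_branch x y))"
proof -
  let ?V = "L \<inter> (if x \<in> A then UNIV else W x)"
  let ?p = "\<lambda>y. (cell n y, if y \<in> ?V then None else Some (off_branch x y))"
  obtain N where N: "openin T N" "g \<in> N"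
    "\<And>h E. h \<in> N \<Longrightarrow> odd (card {y \<in> support h. ?p y \<in> E}) = odd (card {y \<in> support g. ?p y \<in> E})"
    using support_parity_locally_constant[OF refined_partition(3)[OF shape x, of A n] g] by blast
  have sub: "h \<in> carrier G" if "h \<in> N" for h
    using openin_subset[OF N(1)] that topspace_T by auto
  show thesis
  proof (rule that[OF N(1,2)])
    fix h k z assume h: "h \<in> N" and k: "k \<le> n"
    let ?E = "{q. fst q \<inter> {..<k} = cell k z}"
    have "cell n y \<inter> {..<k} = cell k y" for y using k by (auto simp: cell_def)
    then have "{y \<in> P. ?p y \<in> ?E} = {y \<in> P. cell k y = cell k z}" for P by simp
    then show "odd (card {y \<in> support h. cell k y = cell k z}) = odd (card {y \<in> support g. cell k y = cell k z})"
      using N(3)[OF h, of ?E] by (simp only:)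
  next
    fix h y assume h: "h \<in> N" and y: "y \<in> L" "y \<notin> (if x \<in> A then UNIV else W x)"
    then have fib: "{z \<in> L. snd (?p z) = Some (off_branch x y)} = off_branch x y"
      by (intro refined_partition(4)[OF shape x, of _ A n]) auto
    let ?E = "{q. snd q = Some (off_branch x y)}"
    have "{z \<in> support f. ?p z \<in> ?E} = support f \<inter> off_branch x y" if "f \<in> carrier G" for f
    proof -
      have "support f \<subseteq> L" using support_Fpow[OF that] by simp
      then show ?thesis using fib by blast
    qed
    then show "odd (card (support h \<inter> off_branch x y)) = odd (card (support g \<inter> off_branch x y))"
      using N(3)[OF h, of ?E] sub[OF h] g by (simp only:)
  qed
qed

text \<open>Near a group element whose support selects \<open>x\<close>, parity forces the selected point \<open>y\<close> into
  a small cell of \<open>x\<close>; if \<open>y\<close> left the basic neighbourhood of \<open>x\<close>, then the whole branch of \<open>y\<close>,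
  which misses the original support, would be odd.\<close>

lemma continuous_select:
  assumes x0: "x\<^sub>0 \<in> L"
  shows "continuous_map T (refined_topology L A W) (\<lambda>g. select x\<^sub>0 (support g))"
  unfolding continuous_map_def
proof (intro conjI allI impI)
  let ?r = "\<lambda>g. select x\<^sub>0 (support g)" and ?X = "refined_topology L A W"
  have sup: "finite (support g)" "support g \<subseteq> L" if "g \<in> carrier G" for g
    using support_Fpow[OF that] by simp_all
  have rL: "?r g \<in> L" if "g \<in> carrier G" for g
    using select_in[OF sup[OF that] x0] .
  then show "?r \<in> topspace T \<rightarrow> topspace ?X" by (simp add: topspace_T)
  fix U assume U: "openin ?X U"
  have "\<exists>N. openin T N \<and> g \<in> N \<and> N \<subseteq> {g \<in> topspace T. ?r g \<in> U}" if g: "g \<in> carrier G" "?r g \<in> U" for g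
  proof -
    define x where "x = ?r g"
    have x: "x \<in> L" "x \<in> U" using rL g by (simp_all add: x_def)
    let ?W = "if x \<in> A then UNIV else W x"
    obtain e where e: "e > 0" "L \<inter> ball x e \<inter> ?W \<subseteq> U" using refined_nbhd[OF shape U x(2)] by blast
    obtain n0 where n0: "\<And>y. y \<in> L \<Longrightarrow> cell n0 y = cell n0 x \<Longrightarrow> y \<in> ball x e"
      using cell_subset_ball[OF e(1)] by blast
    obtain n1 where n1: "\<And>n y. n1 \<le> n \<Longrightarrow> y \<in> support g \<Longrightarrow> cell n y = cell n x \<Longrightarrow> y = x"
      using eventually_cell_isolates[OF sup(1)[OF g(1)], of x] unfolding eventually_sequentially by blast
    \<comment> \<open>Level \<open>n0\<close> forces points into the ball, and level
      \<open>n1\<close> isolates \<open>x\<close> from the rest of the support of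
      \<open>g\<close>.\<close>
    define n where "n = max n0 n1"
    obtain N where N: "openin T N" "g \<in> N"
      "\<And>h k z. h \<in> N \<Longrightarrow> k \<le> n \<Longrightarrow>
        odd (card {y \<in> support h. cell k y = cell k z}) = odd (card {y \<in> support g. cell k y = cell k z})"
      "\<And>h y. h \<in> N \<Longrightarrow> y \<in> L \<Longrightarrow> y \<notin> ?W \<Longrightarrow>
        odd (card (support h \<inter> off_branch x y)) = odd (card (support g \<inter> off_branch x y))"
      by (rule odd_support_locally_constant[OF g(1) x(1), of n]) (rule that, assumption+)
    have "?r h \<in> U" if h: "h \<in> N" for h
    proof -
      have hG: "h \<in> carrier G" using h openin_subset[OF N(1)] topspace_T by auto
      have card0: "odd (card (support h)) = odd (card (support g))"
        using N(3)[OF h, of 0] by (simp add: cell_def)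
      show ?thesis
      proof (cases "odd (card (support g))")
        \<comment> \<open>Here both selections are the default value, the parity of the whole
          support being that of level 0.\<close>
        case False
        then have "?r h = ?r g" using card0 by (simp add: select_def)
        then show ?thesis using g(2) by simp
      next
        case True
        define y where "y = ?r h"
        have yL: "y \<in> L" using rL[OF hG] by (simp add: y_def)
        have "cell n y = cell n x"
          unfolding x_def y_def
          by (rule select_cell_cong) (use sup g(1) hG True N(3)[OF h] in auto)
        have "y \<in> ?W"
        proof (rule ccontr)
          assume y: "y \<notin> ?W"
          moreover have "x \<in> ?W" using shape by (simp add: nbhd_shape_def)
          ultimately have "x \<noteq> y" by metis
          have "odd_branch (support h) y"
            unfolding y_def using sup[OF hG] True card0 by (intro odd_branch_select(1)) auto
          moreover obtain m where "off_branch x y = {z \<in> L. cell m z = cell m y}"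
            by (auto simp: off_branch_def Let_def)
          moreover from this have "support h \<inter> off_branch x y = {z \<in> support h. cell m z = cell m y}"
            using sup[OF hG] by auto
          ultimately have "odd (card (support h \<inter> off_branch x y))" by (simp add: odd_branch_def)
          then have "odd (card (support g \<inter> off_branch x y))" using N(4)[OF h yL y] by simp
          then have "support g \<inter> off_branch x y \<noteq> {}" by (intro notI) simp
          then obtain z where z: "z \<in> support g" "z \<in> off_branch x y" by blast
          have "cell n z = cell n x" by (rule cell_off_branch) fact+
          then have "z = x" using n1[of n z] z by (simp add: n_def)
          then show False using off_branch_cong(1)[OF \<open>x \<noteq> y\<close> z(2)] by simp
        qed
        moreover have "y \<in> ball x e"
          using n0[OF yL] cell_eq_antimono[OF \<open>cell n y = cell n x\<close>, of n0] by (simp add: n_def)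
        ultimately show ?thesis using e(2) yL unfolding y_def by blast
      qed
    qed
    then show ?thesis using N(1,2) openin_subset[OF N(1)] by (intro exI[of _ N]) auto
  qed
  then show "openin T {g \<in> topspace T. ?r g \<in> U}"
    by (subst openin_subopen) (simp add: topspace_T)
qed

lemma retraction_exists:
  assumes "L \<noteq> {}"
  obtains r where "continuous_map T (refined_topology L A W) r" "\<And>x. x \<in> L \<Longrightarrow> r (\<iota> x) = x"
proof -
  obtain x\<^sub>0 where "x\<^sub>0 \<in> L" using assms by blast
  then show thesis
    using that[OF continuous_select] support_\<iota> by simp
qed

text \<open>Take a letter \<open>x\<close> in exactly one of the two supports and a cell of
  \<open>x\<close> containing no other letter of either. The parity on this cell is locally constant
  and differs for the two elements.\<close>

lemma t1_space_T: "t1_space T"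
  unfolding t1_space_def
proof (intro ballI impI)
  fix g h assume "g \<in> topspace T" "h \<in> topspace T" "g \<noteq> h"
  then have gh: "g \<in> carrier G" "h \<in> carrier G" "support g \<noteq> support h"
    using inj_on_support by (auto simp: topspace_T inj_on_def)
  let ?P = "support g \<union> support h"
  have fin: "finite ?P" "?P \<subseteq> L" using support_Fpow gh by auto
  obtain x where x: "x \<in> ?P" "(x \<in> support g) \<noteq> (x \<in> support h)" using gh(3) by blast
  obtain n where n: "\<And>y. y \<in> ?P \<Longrightarrow> cell n y = cell n x \<Longrightarrow> y = x"
    using eventually_cell_isolates[OF fin(1), of x] unfolding eventually_sequentially by blast
  have "x \<in> L" using x fin by blast
  obtain N where N: "openin T N" "g \<in> N"
    "\<And>h k z. h \<in> N \<Longrightarrow> k \<le> n \<Longrightarrow>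
      odd (card {y \<in> support h. cell k y = cell k z}) = odd (card {y \<in> support g. cell k y = cell k z})"
    by (rule odd_support_locally_constant[OF gh(1) \<open>x \<in> L\<close>, of n]) (rule that, assumption+)
  have "{y \<in> support f. cell n y = cell n x} = (if x \<in> support f then {x} else {})" if "support f \<subseteq> ?P" for f
    using n that by auto
  then have "odd (card {y \<in> support f. cell n y = cell n x}) \<longleftrightarrow> x \<in> support f" if "support f \<subseteq> ?P" for f
    using that by simp
  then have "h \<notin> N" using N(3)[of h n x] x(2) by blast
  then show "\<exists>U. openin T U \<and> g \<in> U \<and> h \<notin> U" using N by blast
qed

text \<open>An element is determined by its finite support, and the reals have no more finite
  subsets than points.\<close>

lemma carrier_lepoll: "carrier G \<lesssim> (UNIV :: real set)"
proof -
  have "support ` carrier G \<subseteq> Fpow UNIV" using support_Fpow by (auto simp: Fpow_def)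
  then have "carrier G \<lesssim> Fpow (UNIV :: real set)"
    using inj_on_support by (auto simp: lepoll_def)
  also have "\<dots> \<approx> (UNIV :: real set)"
    by (rule eqpoll_Fpow) (rule infinite_UNIV_char_0)
  finally show ?thesis .
qed

end

section \<open>The product of two groups with linked retractions\<close>

lemma real_times_real_lepoll: "(UNIV :: real set) \<times> (UNIV :: real set) \<lesssim> (UNIV :: real set)"
proof -
  have "(UNIV :: real set) \<times> (UNIV :: real set) \<approx> (UNIV :: real set)"
    unfolding eqpoll_iff_card_of_ordIso
    by (rule card_of_Times_same_infinite) (rule infinite_UNIV_char_0)
  then show ?thesis by (rule eqpoll_imp_lepoll)
qed

lemma TG_sm_imp_SG_cnw: "TG_sm G T \<Longrightarrow> SG_cnw G T"
proof -
  assume G: "TG_sm G T"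
  then have tg: "group_with_topology G T"
    and mult: "continuous_map (prod_topology T T) T (\<lambda>(x, y). x \<otimes>\<^bsub>G\<^esub> y)"
    by (auto simp: TG_sm_def topological_group_def)
  have "continuous_map T T (\<lambda>x. a \<otimes>\<^bsub>G\<^esub> x)" "continuous_map T T (\<lambda>x. x \<otimes>\<^bsub>G\<^esub> a)"
    if "a \<in> carrier G" for a
  proof -
    have a: "a \<in> topspace T" using that tg by (simp add: group_with_topology_def)
    then have "continuous_map T (prod_topology T T) (\<lambda>x. (a, x))"
      "continuous_map T (prod_topology T T) (\<lambda>x. (x, a))"
      by (simp_all add: continuous_map_paired)
    from this[THEN continuous_map_compose, OF mult]
    show "continuous_map T T (\<lambda>x. a \<otimes>\<^bsub>G\<^esub> x)" "continuous_map T T (\<lambda>x. x \<otimes>\<^bsub>G\<^esub> a)"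
      by (simp_all add: o_def)
  qed
  moreover have "second_countable T"
    using G by (simp add: TG_sm_def separable_metrizable_imp_second_countable)
  then have "has_countable_network T"
    unfolding second_countable_def has_countable_network_def by metis
  ultimately show ?thesis using tg by (simp add: SG_cnw_def semitopological_group_def)
qed

lemma R_factorizable_imp_SG_cnw: "R_factorizable G T \<Longrightarrow> factorizable SG_cnw G T"
  unfolding R_factorizable_def factorizable_def
  by (elim all_forward imp_forward ex_forward conj_forward) (auto simp: TG_sm_imp_SG_cnw)

text \<open>Every subset \<open>S\<close> of \<open>D\<close> is closed, so normality separates it
  from \<open>D - S\<close> by open sets, and the trace of \<open>U S\<close> on a countable dense
  set \<open>E\<close> determines \<open>S\<close>. Thus \<open>Pow D\<close> embeds into the
  subsets of the naturals and hence into \<open>D\<close>, against Cantor's theorem.\<close>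

lemma Jones_lemma:
  assumes sep: "separable_space X" and norm: "normal_space X"
    and D: "closedin X D" "subtopology X D = discrete_topology D"
  shows "\<not> (UNIV :: real set) \<lesssim> D"
proof
  assume "(UNIV :: real set) \<lesssim> D"
  obtain E where E: "countable E" "E \<subseteq> topspace X" "X closure_of E = topspace X"
    using sep by (auto simp: separable_space_def)
  have "closedin X S" if "S \<subseteq> D" for S
  proof -
    have "closedin (subtopology X D) S" using that D(2) by simp
    then show ?thesis using D(1) closedin_trans_full by blast
  qed
  then have "\<exists>U V. openin X U \<and> openin X V \<and> S \<subseteq> U \<and> D - S \<subseteq> V \<and> disjnt U V" if "S \<subseteq> D" for S
    using norm that unfolding normal_space_def by (simp add: disjnt_def)
  then obtain U V where UV: "\<And>S. S \<subseteq> D \<Longrightarrow> openin X (U S) \<and> openin X (V S) \<and> S \<subseteq> U S \<and> D - S \<subseteq> V S \<and> disjnt (U S) (V S)"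
    by metis
  have sub: "S \<subseteq> S'" if S: "S \<subseteq> D" "S' \<subseteq> D" and eq: "U S \<inter> E = U S' \<inter> E" for S S'
  proof
    fix x assume x: "x \<in> S"
    show "x \<in> S'"
    proof (rule ccontr)
      assume "x \<notin> S'"
      \<comment> \<open>The open set \<open>U S \<inter> V S'\<close> is now nonempty and meets
        \<open>E\<close>, at a point of \<open>U S'\<close> by equality of traces; but
        \<open>U S'\<close> and \<open>V S'\<close> are disjoint.\<close>
      then have "x \<in> U S \<inter> V S'" using x S UV[OF S(1)] UV[OF S(2)] by blast
      moreover have "openin X (U S \<inter> V S')" using UV S by blast
      ultimately obtain e where "e \<in> E" "e \<in> U S" "e \<in> V S'"
        using E(3) unfolding dense_intersects_open by blast
      then show False using eq UV[OF S(2)] by (auto simp: disjnt_def)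
    qed
  qed
  have "inj_on (\<lambda>S. to_nat_on E ` (U S \<inter> E)) (Pow D)"
  proof (rule inj_onI)
    fix S S' assume S: "S \<in> Pow D" "S' \<in> Pow D"
      and "to_nat_on E ` (U S \<inter> E) = to_nat_on E ` (U S' \<inter> E)"
    then have "U S \<inter> E = U S' \<inter> E"
      using inj_on_image_eq_iff[OF inj_on_to_nat_on[OF E(1)]] by (metis Int_lower2)
    then show "S = S'" using sub[of S S'] sub[of S' S] S by auto
  qed
  then have "Pow D \<lesssim> (UNIV :: nat set set)" by (auto simp: lepoll_def)
  also have "(UNIV :: nat set set) \<approx> (UNIV :: real set)" by (rule nat_sets_eqpoll_reals)
  also have "(UNIV :: real set) \<lesssim> D" by fact
  finally show False using lesspoll_Pow_self[of D] by (meson lesspoll_trans1 lesspoll_not_refl lesspoll_trans2)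
qed

text \<open>The common setting of both products. The two retractions can agree only in
  \<open>L \<inter> R = C\<close>, and at points of \<open>C\<close> complementary half-lines are
  open in the two spaces.\<close>

locale order_linked_groups =
  fixes X Y :: "real topology" and L R C :: "real set"
    and G :: "'g monoid" and T i r and H :: "'h monoid" and T' j s
  assumes X: "topspace X = L" "\<And>U. open U \<Longrightarrow> openin X (L \<inter> U)" "\<And>c. c \<in> C \<Longrightarrow> openin X (L \<inter> {..c})"
    and Y: "topspace Y = R" "\<And>U. open U \<Longrightarrow> openin Y (R \<inter> U)" "\<And>c. c \<in> C \<Longrightarrow> openin Y (R \<inter> {c..})"
    and C: "L \<inter> R = C" "C \<approx> (UNIV :: real set)"
    and G: "group_with_topology G T" "t1_space T" "carrier G \<lesssim> (UNIV :: real set)"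
    and H: "group_with_topology H T'" "t1_space T'" "carrier H \<lesssim> (UNIV :: real set)"
    and r: "continuous_map T X r" and s: "continuous_map T' Y s"
    and i: "\<And>c. c \<in> C \<Longrightarrow> i c \<in> carrier G \<and> r (i c) = c"
    and j: "\<And>c. c \<in> C \<Longrightarrow> j c \<in> carrier H \<and> s (j c) = c"
begin

abbreviation "P \<equiv> prod_topology T T'"

lemma topspaces: "topspace T = carrier G" "topspace T' = carrier H" "topspace P = carrier G \<times> carrier H"
  using G(1) H(1) by (simp_all add: group_with_topology_def)

lemma openin_box:
  assumes "openin X U" "openin Y V"
  shows "openin P {p \<in> carrier G \<times> carrier H. r (fst p) \<in> U \<and> s (snd p) \<in> V}"
proof -
  have "openin T {g \<in> carrier G. r g \<in> U}" "openin T' {h \<in> carrier H. s h \<in> V}"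
    using openin_continuous_map_preimage[OF r assms(1)] openin_continuous_map_preimage[OF s assms(2)]
    by (simp_all add: topspaces)
  then have "openin P ({g \<in> carrier G. r g \<in> U} \<times> {h \<in> carrier H. s h \<in> V})"
    by (simp add: openin_prod_Times_iff)
  then show ?thesis by (rule back_subst[of "openin P"]) auto
qed

lemma rL: "g \<in> carrier G \<Longrightarrow> r g \<in> L" and sR: "h \<in> carrier H \<Longrightarrow> s h \<in> R"
  using r s X(1) Y(1) topspaces by (auto simp: continuous_map_def)

text \<open>A strict inequality is kept by Euclidean rays on either side of some \<open>m\<close>.
  At equality the common value is in \<open>C\<close>, so the box of the half-lines
  \<open>{..c}\<close> and \<open>{c..}\<close> is open. The bound \<open>m\<close>, uniform on
  \<open>N\<close>, leaves one possible common value.\<close>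

lemma nbhd_le:
  assumes p: "p \<in> carrier G \<times> carrier H" "r (fst p) \<le> s (snd p)"
  obtains N m where "openin P N" "p \<in> N" "N \<subseteq> carrier G \<times> carrier H"
    "\<And>q. q \<in> N \<Longrightarrow> r (fst q) \<le> m \<and> m \<le> s (snd q)"
proof (cases "r (fst p) < s (snd p)")
  case True
  then obtain m where m: "r (fst p) < m" "m < s (snd p)" using dense by blast
  show thesis
    by (rule that[OF openin_box[OF X(2)[OF open_lessThan] Y(2)[OF open_greaterThan]], of m m m])
      (use p m rL sR in auto)
next
  case False
  then have c: "s (snd p) = r (fst p)" "r (fst p) \<in> C" using p rL[of "fst p"] sR[of "snd p"] C(1) by auto
  then have c': "r (fst p) \<in> L" "r (fst p) \<in> R" using C(1) by auto
  show thesis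
    by (rule that[OF openin_box[OF X(3)[OF c(2)] Y(3)[OF c(2)]], of "r (fst p)"])
      (use p c c' in auto)
qed

lemma nbhd_gt:
  assumes p: "p \<in> carrier G \<times> carrier H" "s (snd p) < r (fst p)"
  obtains N where "openin P N" "p \<in> N" "N \<subseteq> carrier G \<times> carrier H"
    "\<And>q. q \<in> N \<Longrightarrow> s (snd q) < r (fst q)"
proof -
  obtain m where m: "s (snd p) < m" "m < r (fst p)" using dense p(2) by blast
  show thesis
    by (rule that[OF openin_box[OF X(2)[OF open_greaterThan] Y(2)[OF open_lessThan]], of m m])
      (use p m rL sR in auto)
qed

lemma nbhd_diagonal:
  assumes "p \<in> topspace P"
  obtains N c where "openin P N" "p \<in> N" "\<And>q. q \<in> N \<Longrightarrow> r (fst q) = s (snd q) \<Longrightarrow> r (fst q) = c"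
proof (cases "r (fst p) \<le> s (snd p)")
  case True
  have "p \<in> carrier G \<times> carrier H" using assms topspaces by simp
  then obtain N m where N: "openin P N" "p \<in> N" "N \<subseteq> carrier G \<times> carrier H"
    "\<And>q. q \<in> N \<Longrightarrow> r (fst q) \<le> m \<and> m \<le> s (snd q)"
    by (rule nbhd_le[OF _ True]) (rule that, assumption+)
  show ?thesis by (rule that[OF N(1,2), of m]) (use N(4) in force)
next
  case False
  have "p \<in> carrier G \<times> carrier H" using assms topspaces by simp
  then obtain N where N: "openin P N" "p \<in> N" "N \<subseteq> carrier G \<times> carrier H"
    "\<And>q. q \<in> N \<Longrightarrow> s (snd q) < r (fst q)"
    by (rule nbhd_gt[OF _ False[unfolded not_le]]) (rule that, assumption+)
  \<comment> \<open>The retractions never agree on \<open>N\<close>, so 0 is a dummy value.\<close>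
  show ?thesis by (rule that[OF N(1,2), of 0]) (use N(4) in force)
qed

definition F :: "'g \<times> 'h \<Rightarrow> real" where
  "F p = (if r (fst p) \<le> s (snd p) then 1 else 0)"

lemma continuous_F: "continuous_map P euclideanreal F"
  unfolding continuous_map_def
proof (intro conjI allI impI)
  fix U :: "real set"
  have "\<exists>N. openin P N \<and> p \<in> N \<and> N \<subseteq> {p \<in> topspace P. F p \<in> U}"
    if p: "p \<in> topspace P" "F p \<in> U" for p
  proof -
    have p': "p \<in> carrier G \<times> carrier H" using p topspaces by simp
    show ?thesis
    proof (cases "r (fst p) \<le> s (snd p)")
      case True
      obtain N m where N: "openin P N" "p \<in> N" "N \<subseteq> carrier G \<times> carrier H"
        "\<And>q. q \<in> N \<Longrightarrow> r (fst q) \<le> m \<and> m \<le> s (snd q)"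
        by (rule nbhd_le[OF p' True]) (rule that, assumption+)
      have "q \<in> {p \<in> topspace P. F p \<in> U}" if "q \<in> N" for q
        using N(3) N(4)[OF that] that True p(2) unfolding topspaces F_def by auto
      then show ?thesis using N(1,2) by (intro exI[of _ N] conjI subsetI)
    next
      case False
      obtain N where N: "openin P N" "p \<in> N" "N \<subseteq> carrier G \<times> carrier H"
        "\<And>q. q \<in> N \<Longrightarrow> s (snd q) < r (fst q)"
        by (rule nbhd_gt[OF p' False[unfolded not_le]]) (rule that, assumption+)
      have "q \<in> {p \<in> topspace P. F p \<in> U}" if "q \<in> N" for q
        using N(3) N(4)[OF that] that False p(2) unfolding topspaces F_def by auto
      then show ?thesis using N(1,2) by (intro exI[of _ N] conjI subsetI)
    qed
  qed
  then show "openin P {p \<in> topspace P. F p \<in> U}" by (subst openin_subopen) blast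
qed simp

lemma uncountable_C: "uncountable C"
  using countable_eqpoll[OF _ eqpoll_sym[OF C(2)]] uncountable_UNIV_real by auto

text \<open>In a factorization \<open>F = f \<circ> \<phi>\<close> the points \<open>\<phi> (\<one>, j c)\<close> form a right-separated subspace:
  the set of those with index at least \<open>c\<close> is cut out by an open set, which only uses that left
  translation by \<open>\<phi> (i c, \<one>)\<close> is continuous.\<close>

lemma not_factorizable: "\<not> factorizable SG_cnw (G \<times>\<times> H) P"
proof
  interpret G: group G using G(1) by (simp add: group_with_topology_def)
  interpret H: group H using H(1) by (simp add: group_with_topology_def)
  assume "factorizable SG_cnw (G \<times>\<times> H) P"
  from this[unfolded factorizable_def, rule_format, OF continuous_F]
  obtain K :: "('g \<times> 'h) monoid" and S \<phi> f where K: "SG_cnw K S" and \<phi>: "\<phi> \<in> hom (G \<times>\<times> H) K"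
    and f: "continuous_map S euclideanreal f" and eq: "\<forall>p\<in>carrier (G \<times>\<times> H). F p = f (\<phi> p)"
    by blast
  \<comment> \<open>Since \<open>(i c, j c')\<close> is the product of \<open>(i c, \<one>)\<close>
    and \<open>(\<one>, j c')\<close>, its image splits into factors depending on one index
    each.\<close>
  define a where "a c = \<phi> (i c, \<one>\<^bsub>H\<^esub>)" for c
  define b where "b c = \<phi> (\<one>\<^bsub>G\<^esub>, j c)" for c
  have topS: "topspace S = carrier K"
    using K by (simp add: SG_cnw_def semitopological_group_def group_with_topology_def)
  have ab: "a c \<in> carrier K" "b c \<in> carrier K" if "c \<in> C" for c
    using \<phi> that i j by (auto simp: a_def b_def hom_def Pi_iff)
  have le: "f (a c \<otimes>\<^bsub>K\<^esub> b c') > 0 \<longleftrightarrow> c \<le> c'" if c: "c \<in> C" "c' \<in> C" for c c'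
  proof -
    have "a c \<otimes>\<^bsub>K\<^esub> b c' = \<phi> ((i c, \<one>\<^bsub>H\<^esub>) \<otimes>\<^bsub>G \<times>\<times> H\<^esub> (\<one>\<^bsub>G\<^esub>, j c'))"
      using hom_mult[OF \<phi>, of "(i c, \<one>\<^bsub>H\<^esub>)" "(\<one>\<^bsub>G\<^esub>, j c')"] c i j by (simp add: a_def b_def)
    also have "\<dots> = \<phi> (i c, j c')" using c i j by simp
    finally have "f (a c \<otimes>\<^bsub>K\<^esub> b c') = F (i c, j c')" using eq c i j by simp
    then show ?thesis using c i j by (simp add: F_def)
  qed
  define U where "U c = {x \<in> topspace S. f (a c \<otimes>\<^bsub>K\<^esub> x) \<in> {0<..}}" for c
  have opU: "openin S (U c)" if "c \<in> C" for c
  proof -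
    have "continuous_map S S (\<lambda>x. a c \<otimes>\<^bsub>K\<^esub> x)"
      using K ab(1)[OF that] by (simp add: SG_cnw_def semitopological_group_def)
    from continuous_map_compose[OF this f] have "continuous_map S euclideanreal (\<lambda>x. f (a c \<otimes>\<^bsub>K\<^esub> x))"
      by (simp add: o_def)
    then show ?thesis
      unfolding U_def by (rule openin_continuous_map_preimage) simp
  qed
  have U: "b c' \<in> U c \<longleftrightarrow> c \<le> c'" if "c \<in> C" "c' \<in> C" for c c'
    using le[OF that] ab(2)[OF that(2)] by (simp add: U_def topS)
  have "has_countable_network S" using K by (simp add: SG_cnw_def)
  then obtain \<N> where \<N>: "countable \<N>" "\<forall>V x. openin S V \<and> x \<in> V \<longrightarrow> (\<exists>N\<in>\<N>. x \<in> N \<and> N \<subseteq> V)"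
    unfolding has_countable_network_def by (elim exE conjE)
  have "\<exists>N\<in>\<N>. b c \<in> N \<and> N \<subseteq> U c" if "c \<in> C" for c
    using \<N>(2) opU[OF that] U[OF that that] by blast
  then obtain N where N: "\<And>c. c \<in> C \<Longrightarrow> N c \<in> \<N> \<and> b c \<in> N c \<and> N c \<subseteq> U c" by metis
  \<comment> \<open>If two indices share a network member, then \<open>b c'\<close> lies in
    \<open>U c\<close> and \<open>b c\<close> in \<open>U c'\<close>, which gives both
    inequalities.\<close>
  have "inj_on N C"
  proof (rule inj_onI)
    fix c c' assume c: "c \<in> C" "c' \<in> C" "N c = N c'"
    then have "b c' \<in> U c" "b c \<in> U c'" using N[OF c(1)] N[OF c(2)] by auto
    then show "c = c'" using U c by force
  qed
  moreover have "countable (N ` C)"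
    using \<N>(1) N by (intro countable_subset[of "N ` C" \<N>]) auto
  ultimately have "countable C" by (simp add: countable_image_inj_eq)
  then show False using uncountable_C by simp
qed

lemma carrier_product_lepoll: "carrier G \<times> carrier H \<lesssim> (UNIV :: real set)"
  by (rule lepoll_trans[OF times_lepoll_mono[OF G(3) H(3)] real_times_real_lepoll])

definition diagonal :: "('g \<times> 'h) set" where
  "diagonal = (\<lambda>c. (i c, j c)) ` C"

lemma diagonal_eqpoll: "(UNIV :: real set) \<approx> diagonal"
proof -
  have "inj_on (\<lambda>c. (i c, j c)) C"
  proof (rule inj_onI)
    fix c d assume cd: "c \<in> C" "d \<in> C" "(i c, j c) = (i d, j d)"
    from cd(3) have "r (i c) = r (i d)" by (simp only: prod.inject)
    then show "c = d" using i[OF cd(1)] i[OF cd(2)] by linarith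
  qed
  then have "diagonal \<approx> C" unfolding diagonal_def by (rule inj_on_image_eqpoll_self)
  then show ?thesis by (rule eqpoll_trans[OF eqpoll_sym[OF C(2)] eqpoll_sym])
qed

text \<open>In a T1 space every neighbourhood of an accumulation point contains infinitely many
  points of the set, while \<open>nbhd_diagonal\<close> provides neighbourhoods containing at most
  one. So the derived set is empty.\<close>

lemma diagonal_closed_discrete:
  "closedin P diagonal" "subtopology P diagonal = discrete_topology diagonal"
proof -
  have "t1_space P" using G(2) H(2) by (simp add: t1_space_prod_topology)
  then have *: "P derived_set_of diagonal =
      {x \<in> topspace P. \<forall>U. x \<in> U \<and> openin P U \<longrightarrow> infinite (diagonal \<inter> U)}"
    by (simp add: t1_space_derived_set_of_infinite_openin)
  have derived: "P derived_set_of diagonal = {}"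
  proof -
    have "\<exists>U. x \<in> U \<and> openin P U \<and> finite (diagonal \<inter> U)" if x: "x \<in> topspace P" for x
    proof -
      obtain N c where N: "openin P N" "x \<in> N" "\<And>q. q \<in> N \<Longrightarrow> r (fst q) = s (snd q) \<Longrightarrow> r (fst q) = c"
        by (rule nbhd_diagonal[OF x]) (rule that, assumption+)
      have "q = (i c, j c)" if q: "q \<in> diagonal \<inter> N" for q
      proof -
        obtain d where d: "d \<in> C" "q = (i d, j d)" using q by (auto simp: diagonal_def)
        then have "d = c" using N(3)[of q] q i j by simp
        then show ?thesis using d by simp
      qed
      then have "diagonal \<inter> N \<subseteq> {(i c, j c)}" by blast
      then show ?thesis using N finite_subset by blast
    qed
    then show ?thesis unfolding * by blast
  qed
  have "diagonal \<subseteq> topspace P" using i j topspaces by (auto simp: diagonal_def)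
  then show "closedin P diagonal" "subtopology P diagonal = discrete_topology diagonal"
    using derived by (simp_all add: closedin_contains_derived_set subtopology_eq_discrete_topology_eq)
qed

lemma extent: "extent_is P (UNIV :: real set)"
  unfolding extent_is_def sup_card_is_def
proof (intro conjI ballI allI impI)
  fix D assume "D \<in> {D. closedin P D \<and> subtopology P D = discrete_topology D}"
  then have "D \<subseteq> carrier G \<times> carrier H" using closedin_subset topspaces by fastforce
  then show "D \<lesssim> (UNIV :: real set)"
    using carrier_product_lepoll subset_imp_lepoll lepoll_trans by blast
next
  fix Z :: "real set"
  assume "\<forall>D\<in>{D. closedin P D \<and> subtopology P D = discrete_topology D}. D \<lesssim> Z"
  then have "diagonal \<lesssim> Z" using diagonal_closed_discrete by blast
  then show "(UNIV :: real set) \<lesssim> Z" using diagonal_eqpoll by (rule lepoll_trans1[rotated])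
qed

lemma not_normal: "separable_space T \<Longrightarrow> separable_space T' \<Longrightarrow> \<not> normal_space P"
  and separable: "separable_space T \<Longrightarrow> separable_space T' \<Longrightarrow> separable_space P"
proof -
  assume sep: "separable_space T" "separable_space T'"
  obtain D where D: "countable D" "D \<subseteq> topspace T" "T closure_of D = topspace T"
    using sep(1) by (auto simp: separable_space_def)
  obtain E where E: "countable E" "E \<subseteq> topspace T'" "T' closure_of E = topspace T'"
    using sep(2) by (auto simp: separable_space_def)
  show sepP: "separable_space P"
    unfolding separable_space_def
    using D E by (intro exI[of _ "D \<times> E"]) (auto simp: closure_of_Times)
  show "\<not> normal_space P"
    using Jones_lemma[OF sepP _ diagonal_closed_discrete]
      eqpoll_imp_lepoll[OF diagonal_eqpoll] by blast
qed

text \<open>Points chosen from the members of a discrete family are distinct, so the cardinality of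
  the product is an upper bound. It is attained by the boxes over single points of \<open>C\<close>,
  discrete by \<open>nbhd_diagonal\<close>.\<close>

lemma discrete_suslin_number:
  assumes iso: "\<And>c. c \<in> C \<Longrightarrow> openin X {c} \<and> openin Y {c}"
  shows "discrete_suslin_number_is P (UNIV :: real set)"
  unfolding discrete_suslin_number_is_def sup_card_is_def
proof (intro conjI ballI allI impI)
  fix \<V> assume "\<V> \<in> {\<V>. (\<forall>V\<in>\<V>. openin P V \<and> V \<noteq> {}) \<and> discrete_family P \<V>}"
  then have \<V>: "\<And>V. V \<in> \<V> \<Longrightarrow> openin P V \<and> V \<noteq> {}" "discrete_family P \<V>" by auto
  then have "\<forall>V\<in>\<V>. \<exists>p. p \<in> V" by blast
  then obtain p where p: "\<And>V. V \<in> \<V> \<Longrightarrow> p V \<in> V" by metis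
  have top: "p V \<in> topspace P" if "V \<in> \<V>" for V
    using p[OF that] \<V>(1)[OF that] openin_subset by blast
  have "inj_on p \<V>"
  proof (rule inj_onI)
    fix V V' assume V: "V \<in> \<V>" "V' \<in> \<V>" "p V = p V'"
    from \<V>(2) top[OF V(1)] obtain U where "p V \<in> U"
      "\<forall>V\<in>\<V>. \<forall>W\<in>\<V>. V \<inter> U \<noteq> {} \<and> W \<inter> U \<noteq> {} \<longrightarrow> V = W"
      unfolding discrete_family_def by metis
    then show "V = V'" using V p[OF V(1)] p[OF V(2)] by auto
  qed
  moreover have "p ` \<V> \<subseteq> carrier G \<times> carrier H"
    using top unfolding topspaces by (rule image_subsetI)
  ultimately have "\<V> \<lesssim> carrier G \<times> carrier H" unfolding lepoll_def by blast
  then show "\<V> \<lesssim> (UNIV :: real set)" using carrier_product_lepoll lepoll_trans by blast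
next
  fix Z :: "real set"
  assume Z: "\<forall>\<V>\<in>{\<V>. (\<forall>V\<in>\<V>. openin P V \<and> V \<noteq> {}) \<and> discrete_family P \<V>}. \<V> \<lesssim> Z"
  define V where "V c = {p \<in> carrier G \<times> carrier H. r (fst p) \<in> {c} \<and> s (snd p) \<in> {c}}" for c
  have mem: "(i c, j c) \<in> V c" if "c \<in> C" for c using i j that by (simp add: V_def)
  have "openin P (V c)" if "c \<in> C" for c
    unfolding V_def using iso[OF that] by (intro openin_box) auto
  moreover have "discrete_family P (V ` C)"
    unfolding discrete_family_def
  proof
    fix x assume x: "x \<in> topspace P"
    obtain N c where N: "openin P N" "x \<in> N" "\<And>q. q \<in> N \<Longrightarrow> r (fst q) = s (snd q) \<Longrightarrow> r (fst q) = c"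
      by (rule nbhd_diagonal[OF x]) (rule that, assumption+)
    have "d = c" if "V d \<inter> N \<noteq> {}" for d
    proof -
      from that obtain q where "q \<in> V d" "q \<in> N" by blast
      then show ?thesis using N(3)[of q] by (simp add: V_def)
    qed
    then show "\<exists>U. openin P U \<and> x \<in> U \<and> (\<forall>V'\<in>V ` C. \<forall>W\<in>V ` C. V' \<inter> U \<noteq> {} \<and> W \<inter> U \<noteq> {} \<longrightarrow> V' = W)"
      using N(1,2) by (intro exI[of _ N]) blast
  qed
  ultimately have "V ` C \<lesssim> Z" using Z mem by blast
  moreover have "inj_on V C"
  proof (rule inj_onI)
    fix c d assume "c \<in> C" "d \<in> C" "V c = V d"
    then show "c = d" using mem[of c] i[of c] by (simp add: V_def)
  qed
  then have "C \<approx> V ` C" using inj_on_image_eqpoll_self eqpoll_sym by blast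
  ultimately show "(UNIV :: real set) \<lesssim> Z"
    using C(2) by (meson eqpoll_sym lepoll_trans1)
qed

end

section \<open>Application to the given free groups\<close>

lemma order_linked_groups_exist:
  assumes "cuts L b" "cuts R b'" and W: "nbhd_shape W" and V: "nbhd_shape V"
    and G: "free_boolean_topological_group (refined_topology L A W) G T \<iota>"
    and H: "free_boolean_topological_group (refined_topology R B V) H T' \<kappa>"
    and C: "L \<inter> R = C" "C \<approx> (UNIV :: real set)"
    and low: "\<And>c. c \<in> C \<Longrightarrow> openin (refined_topology L A W) (L \<inter> {..c})"
    and up: "\<And>c. c \<in> C \<Longrightarrow> openin (refined_topology R B V) (R \<inter> {c..})"
  shows "\<exists>r s. order_linked_groups (refined_topology L A W) (refined_topology R B V) L R C G T \<iota> r H T' \<kappa> s"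
proof -
  interpret G: free_boolean_refined L b A W G T \<iota>
    using assms by (simp add: free_boolean_refined_def free_boolean_def free_boolean_refined_axioms_def)
  interpret H: free_boolean_refined R b' B V H T' \<kappa>
    using assms by (simp add: free_boolean_refined_def free_boolean_def free_boolean_refined_axioms_def)
  have "C \<noteq> {}" using C(2) infinite_UNIV_char_0 eqpoll_finite_iff by blast
  then have "L \<noteq> {}" "R \<noteq> {}" using C(1) by auto
  obtain r where r: "continuous_map T (refined_topology L A W) r" "\<And>x. x \<in> L \<Longrightarrow> r (\<iota> x) = x"
    using G.retraction_exists[OF \<open>L \<noteq> {}\<close>] by metis
  obtain s where s: "continuous_map T' (refined_topology R B V) s" "\<And>x. x \<in> R \<Longrightarrow> s (\<kappa> x) = x"
    using H.retraction_exists[OF \<open>R \<noteq> {}\<close>] by metis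
  have "order_linked_groups (refined_topology L A W) (refined_topology R B V) L R C G T \<iota> r H T' \<kappa> s"
  proof
    show "group_with_topology G T" "group_with_topology H T'"
      using G.is_group G.topspace_T H.is_group H.topspace_T by (simp_all add: group_with_topology_def)
    show "\<iota> c \<in> carrier G \<and> r (\<iota> c) = c" if "c \<in> C" for c
      using that C(1) r(2) G.\<iota>_closed by auto
    show "\<kappa> c \<in> carrier H \<and> s (\<kappa> c) = c" if "c \<in> C" for c
      using that C(1) s(2) H.\<iota>_closed by auto
  qed (simp_all add: openin_refined_euclidean low up C G.t1_space_T H.t1_space_T
      G.carrier_lepoll H.carrier_lepoll r(1) s(1))
  then show ?thesis by blast
qed

text \<open>Density of \<open>B\<close> yields a point outside \<open>L\<close> between any two
  consecutive naturals, hence the map onto the naturals that reads off word lengths.\<close>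

lemma Lindelof_countable_power_free_refined:
  assumes free: "free_boolean_topological_group (refined_topology L A W) G T \<iota>"
    and lin: "Lindelof_space (countable_power (isolating_topology UNIV A))"
    and AL: "A \<subseteq> L" and W: "nbhd_shape W" and BL: "B \<inter> L = {}"
    and B: "\<And>u v. u < v \<Longrightarrow> \<exists>x\<in>B. u < x \<and> x < v"
  shows "Lindelof_space (countable_power T)"
proof -
  interpret free_boolean "refined_topology L A W" G T \<iota> by unfold_locales (rule free)
  have "\<exists>x\<in>B. real n < x \<and> x < real n + 1" for n by (rule B) simp
  then obtain c where "\<And>n. c n \<in> B \<and> real n < c n \<and> c n < real n + 1" by metis
  then have c: "\<And>n. real n < c n \<and> c n < real n + 1" "\<And>n. c n \<notin> L" using BL by blast+
  have "\<exists>x\<in>L. u < x \<and> x < v" if "u < v" for u v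
    using Lindelof_isolating_imp_dense[OF lin that] AL by blast
  then obtain q where "continuous_map (refined_topology L A W) (discrete_topology UNIV) q" "q ` L = (UNIV :: nat set)"
    using refined_onto_nat[OF c] by metis
  then show ?thesis
    using Lindelof_countable_power_refined[OF lin AL W] by (intro Lindelof_countable_power) simp_all
qed

theorem theorem5:
  fixes I :: "'i set" and M :: "'i \<Rightarrow> real set" and \<alpha>\<^sub>0 \<alpha>\<^sub>1 :: 'i
    and A B C L R :: "real set"
    and G1 :: "'g1 monoid" and TG1 :: "'g1 topology" and \<iota>G1 :: "real \<Rightarrow> 'g1"
    and H1 :: "'h1 monoid" and TH1 :: "'h1 topology" and \<iota>H1 :: "real \<Rightarrow> 'h1"
    and G2 :: "'g2 monoid" and TG2 :: "'g2 topology" and \<iota>G2 :: "real \<Rightarrow> 'g2"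
    and H2 :: "'h2 monoid" and TH2 :: "'h2 topology" and \<iota>H2 :: "real \<Rightarrow> 'h2"
  assumes "I \<approx> (UNIV :: real set)"
    and "\<forall>\<alpha>\<in>I. M \<alpha> \<noteq> {}"
    and "disjoint_family_on M I"
    and "(\<Union>\<alpha>\<in>I. M \<alpha>) = UNIV"
    and "\<forall>\<alpha>\<in>I. Lindelof_space (countable_power (isolating_topology UNIV (M \<alpha>)))"
    and "\<alpha>\<^sub>0 \<in> I" and "\<alpha>\<^sub>1 \<in> I" and "\<alpha>\<^sub>0 \<noteq> \<alpha>\<^sub>1"
    and "A = M \<alpha>\<^sub>0" and "B = M \<alpha>\<^sub>1" and "C = UNIV - (A \<union> B)"
    and "L = A \<union> C" and "R = B \<union> C"
    and "free_boolean_topological_group (isolating_topology L A) G1 TG1 \<iota>G1"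
    and "free_boolean_topological_group (isolating_topology R B) H1 TH1 \<iota>H1"
    and "free_boolean_topological_group (right_closed_topology L A) G2 TG2 \<iota>G2"
    and "free_boolean_topological_group (left_closed_topology R B) H2 TH2 \<iota>H2"
  shows "Lindelof_space (countable_power TG1) \<and> Lindelof_space (countable_power TH1) \<and>
         Lindelof_space (countable_power TG2) \<and> Lindelof_space (countable_power TH2) \<and>
         (\<not> factorizable SG_cnw (G1 \<times>\<times> H1) (prod_topology TG1 TH1) \<and>
          \<not> R_factorizable (G1 \<times>\<times> H1) (prod_topology TG1 TH1) \<and>
          discrete_suslin_number_is (prod_topology TG1 TH1) (UNIV :: real set)) \<and>
         (\<not> factorizable SG_cnw (G2 \<times>\<times> H2) (prod_topology TG2 TH2) \<and>
          \<not> R_factorizable (G2 \<times>\<times> H2) (prod_topology TG2 TH2) \<and>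
          separable_space (prod_topology TG2 TH2) \<and>
          \<not> normal_space (prod_topology TG2 TH2) \<and>
          extent_is (prod_topology TG2 TH2) (UNIV :: real set))"
proof -
  have disj: "A \<inter> B = {}"
    using assms(3,6-10) by (auto simp: disjoint_family_on_def)
  then have L: "L = - B" and R: "R = - A" and LR: "L \<inter> R = C" "L - A = C" "R - B = C"
      "A \<subseteq> L" "B \<subseteq> R" "B \<inter> L = {}" "A \<inter> R = {}"
    using assms(11-13) by auto
  have lin: "Lindelof_space (countable_power (isolating_topology UNIV A))"
      "Lindelof_space (countable_power (isolating_topology UNIV B))"
    using assms(5-7,9,10) by auto
  note dense = lin[THEN Lindelof_isolating_imp_dense]
  \<comment> \<open>Each index other than \<open>\<alpha>\<^sub>0\<close> and
    \<open>\<alpha>\<^sub>1\<close> contributes its own point to \<open>C\<close>, and removing two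
    indices from an infinite set keeps its cardinality.\<close>
  have C: "C \<approx> (UNIV :: real set)"
  proof (rule lepoll_antisym)
    define J where "J = I - {\<alpha>\<^sub>0, \<alpha>\<^sub>1}"
    have "infinite I" using assms(1) infinite_UNIV_char_0 eqpoll_finite_iff by blast
    then have infJ: "infinite J" by (simp add: J_def)
    have I: "I = insert \<alpha>\<^sub>0 (insert \<alpha>\<^sub>1 J)" using assms(6,7) by (auto simp: J_def)
    have "I \<approx> J"
      unfolding I using infinite_insert_eqpoll[OF infJ, of \<alpha>\<^sub>1] infJ
      by (meson eqpoll_trans finite_insert infinite_insert_eqpoll)
    have "\<forall>\<alpha>\<in>J. \<exists>x. x \<in> M \<alpha>" using assms(2) by (auto simp: J_def)
    then obtain x where x: "\<And>\<alpha>. \<alpha> \<in> J \<Longrightarrow> x \<alpha> \<in> M \<alpha>" by metis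
    have dis: "\<alpha> = \<beta>" if "\<alpha> \<in> I" "\<beta> \<in> I" "y \<in> M \<alpha>" "y \<in> M \<beta>" for \<alpha> \<beta> y
      using assms(3) that by (auto simp: disjoint_family_on_def)
    have "inj_on x J" using x dis by (intro inj_onI) (metis DiffD1 J_def)
    moreover have "x ` J \<subseteq> C"
    proof (rule image_subsetI)
      fix \<alpha> assume "\<alpha> \<in> J"
      then have "\<alpha> \<in> I" "\<alpha> \<noteq> \<alpha>\<^sub>0" "\<alpha> \<noteq> \<alpha>\<^sub>1" "x \<alpha> \<in> M \<alpha>" using x by (auto simp: J_def)
      then have "x \<alpha> \<notin> M \<alpha>\<^sub>0" "x \<alpha> \<notin> M \<alpha>\<^sub>1" using dis assms(6,7) by blast+
      then show "x \<alpha> \<in> C" using assms(9-11) by simp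
    qed
    ultimately have "J \<lesssim> C" unfolding lepoll_def by blast
    then show "(UNIV :: real set) \<lesssim> C"
      using assms(1) \<open>I \<approx> J\<close> by (meson eqpoll_sym lepoll_trans1)
  qed (rule subset_imp_lepoll, simp)
  \<comment> \<open>As \<open>L\<close> is the complement of \<open>B\<close>, its cuts are taken
    from \<open>B\<close>; those of \<open>R\<close> are taken from \<open>A\<close>.\<close>
  obtain b where "range b \<subseteq> B" "\<And>u v. u < v \<Longrightarrow> \<exists>n::nat. u < b n \<and> b n < v"
    using dense_sequence[of B] dense(2) by metis
  then have cutL: "cuts L b" using LR(6) by unfold_locales blast+
  obtain a where "range a \<subseteq> A" "\<And>u v. u < v \<Longrightarrow> \<exists>n::nat. u < a n \<and> a n < v"
    using dense_sequence[of A] dense(1) by metis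
  then have cutR: "cuts R a" using LR(7) by unfold_locales blast+
  note free = assms(14-17)[unfolded isolating_topology_eq right_closed_topology_eq left_closed_topology_eq]
  note lind = Lindelof_countable_power_free_refined
  have lindelof: "Lindelof_space (countable_power TG1)" "Lindelof_space (countable_power TH1)"
      "Lindelof_space (countable_power TG2)" "Lindelof_space (countable_power TH2)"
    using lind[OF free(1) lin(1) LR(4) nbhd_shapes(1) LR(6) dense(2)]
      lind[OF free(2) lin(2) LR(5) nbhd_shapes(1) LR(7) dense(1)]
      lind[OF free(3) lin(1) LR(4) nbhd_shapes(2) LR(6) dense(2)]
      lind[OF free(4) lin(2) LR(5) nbhd_shapes(3) LR(7) dense(1)] by blast+
  let ?X = "refined_topology L A (\<lambda>x. {x})" and ?Y = "refined_topology R B (\<lambda>x. {x})"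
  have iso: "openin ?X {c}" "openin ?Y {c}" if "c \<in> C" for c
    using openin_refined_shape[of c L A "\<lambda>x. {x}"] openin_refined_shape[of c R B "\<lambda>x. {x}"] that LR by auto
  \<comment> \<open>Only the endpoint \<open>c\<close> keeps the half-line from being Euclidean open
    in \<open>L\<close>, and \<open>c\<close> is isolated.\<close>
  have low: "openin ?X (L \<inter> {..c})" if "c \<in> C" for c
  proof -
    have eq: "L \<inter> {..c} = (L \<inter> {..<c}) \<union> {c}" using that LR(1) by auto
    show ?thesis unfolding eq using iso(1)[OF that] by (intro openin_Un openin_refined_euclidean) simp_all
  qed
  have up: "openin ?Y (R \<inter> {c..})" if "c \<in> C" for c
  proof -
    have eq: "R \<inter> {c..} = (R \<inter> {c<..}) \<union> {c}" using that LR(1) by auto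
    show ?thesis unfolding eq using iso(2)[OF that] by (intro openin_Un openin_refined_euclidean) simp_all
  qed
  obtain r1 s1 where "order_linked_groups ?X ?Y L R C G1 TG1 \<iota>G1 r1 H1 TH1 \<iota>H1 s1"
    using order_linked_groups_exist[OF cutL cutR nbhd_shapes(1,1) free(1,2) LR(1) C low up] by blast
  then interpret P1: order_linked_groups ?X ?Y L R C G1 TG1 \<iota>G1 r1 H1 TH1 \<iota>H1 s1 .
  let ?X2 = "refined_topology L A (\<lambda>x. {..x})" and ?Y2 = "refined_topology R B (\<lambda>x. {x..})"
  have "openin ?X2 (L \<inter> {..c})" "openin ?Y2 (R \<inter> {c..})" if "c \<in> C" for c
    using openin_refined_shape[of c L A "\<lambda>x. {..x}"] openin_refined_shape[of c R B "\<lambda>x. {x..}"] that LR by auto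
  then obtain r2 s2 where "order_linked_groups ?X2 ?Y2 L R C G2 TG2 \<iota>G2 r2 H2 TH2 \<iota>H2 s2"
    using order_linked_groups_exist[OF cutL cutR nbhd_shapes(2,3) free(3,4) LR(1) C] by blast
  then interpret P2: order_linked_groups ?X2 ?Y2 L R C G2 TG2 \<iota>G2 r2 H2 TH2 \<iota>H2 s2 .
  have denseL: "\<exists>x\<in>L. u < x \<and> x < v" and denseR: "\<exists>x\<in>R. u < x \<and> x < v" if "u < v" for u v
    using dense[OF that] LR(4,5) by blast+
  \<comment> \<open>A basic neighbourhood of \<open>x\<close> contains the trace of an interval
    ending at \<open>x\<close>; for \<open>?Y2\<close> it is one starting at
    \<open>x\<close>.\<close>
  have "separable_space ?X2"
  proof (rule separable_refined[OF nbhd_shapes(2) denseL])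
    show "\<exists>u v. u < v \<and> {u<..<v} \<subseteq> ball x e \<inter> {..x}" if "e > 0" for x e :: real
      using that by (intro exI[of _ "x - e"] exI[of _ x]) (auto simp: dist_real_def)
  qed
  then have sepG: "separable_space TG2"
    using free_boolean.separable_space_free[OF free_boolean.intro[OF free(3)]] by blast
  have "separable_space ?Y2"
  proof (rule separable_refined[OF nbhd_shapes(3) denseR])
    show "\<exists>u v. u < v \<and> {u<..<v} \<subseteq> ball x e \<inter> {x..}" if "e > 0" for x e :: real
      using that by (intro exI[of _ x] exI[of _ "x + e"]) (auto simp: dist_real_def)
  qed
  then have sepH: "separable_space TH2"
    using free_boolean.separable_space_free[OF free_boolean.intro[OF free(4)]] by blast
  show ?thesis
    using lindelof P1.not_factorizable P2.not_factorizable
      R_factorizable_imp_SG_cnw[of "G1 \<times>\<times> H1" "prod_topology TG1 TH1"]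
      R_factorizable_imp_SG_cnw[of "G2 \<times>\<times> H2" "prod_topology TG2 TH2"]
      P1.discrete_suslin_number iso P2.separable[OF sepG sepH] P2.not_normal[OF sepG sepH] P2.extent
    by blast
qed

end
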